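(* Suppose that $\varphi,\xi\in L_1(\mathbb{R})$ are given functions and that $1+(H_1\varphi)(y)\ne 0$ for every $y\in\mathbb{R}$. Then the integral equation $$f(x) + \big(f \underset{H}{*} \varphi\big)(x) =\big(\varphi\underset{H_1,F}{*}\xi\big)(x), \quad x\in\mathbb{R},$$ has a unique solution $f$ in $L_1(\mathbb{R})$, which can be represented in the form $f(x)=\big(\ell\underset{H_1,F}{*}\xi\big)(x)$, where $\ell\in L_1(\mathbb{R})$ is defined by $$(H_1\ell)(y)=\frac{(H_1\varphi)(y)}{1+(H_1\varphi)(y)},\quad y\in\mathbb{R}.$$ Furthermore, $\|f\|_{L_1(\mathbb{R})}\leq\sqrt{\frac{2}{\pi}}\,\|\ell\|_{L_1(\mathbb{R})}\|\xi\|_{L_1(\mathbb{R})}$.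
   Context: The Hartley transform $H_1$ is $(H_1f)(y)=\frac{1}{\sqrt{2\pi}}\int_{\mathbb{R}}f(x)\,(\cos(xy)+\sin(xy))\,dx$, $y\in\mathbb{R}$. The Hartley convolution (given by the same formula for both Hartley transforms $H_1$ and $H_2$, and written here $\underset{H}{*}$) is $$\big(f\underset{H}{*} g\big)(x):= \frac{1}{2\sqrt{2\pi}}\int_{\mathbb{R}} f(y)\,[g(x+y) + g(x-y) + g(-x+y) - g(-x-y)]\, dy,\quad x\in\mathbb{R}.$$ The Hartley-Fourier generalized convolution is $$\big(f\underset{H_1,F}{*}g\big)(x):=\frac{1}{2\sqrt{2\pi}}\int_{\mathbb{R}} g(y)\,[f(x+y)+f(x-y)+i\,f(-x-y)-i\,f(-x+y)]\,dy,\quad x\in\mathbb{R}.$$ *)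

theory Defs
  imports "HOL-Analysis.Analysis"
begin

text \<open>
  \<open>L\<^sub>1(\<real>)\<close> is rendered by complex-valued functions that are Lebesgue integrable; its elements are
  identified when they agree almost everywhere, so every equation in \<open>L\<^sub>1(\<real>)\<close> is stated with
  \<open>AE x in lebesgue\<close>. Functions are complex-valued because the Hartley-Fourier convolution has
  complex coefficients.
\<close>

definition L1 :: "(real \<Rightarrow> complex) set" where
  "L1 = {f. integrable lebesgue f}"

definition L1_norm :: "(real \<Rightarrow> complex) \<Rightarrow> real" where
  "L1_norm f = (LINT x|lebesgue. norm (f x))"

definition hartley_H1 :: "(real \<Rightarrow> complex) \<Rightarrow> real \<Rightarrow> complex" where
  "hartley_H1 f y =
     complex_of_real (1 / sqrt (2 * pi)) *
     (LINT x|lebesgue. f x * complex_of_real (cos (x * y) + sin (x * y)))"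

text \<open>
  For integrable \<open>f\<close> and \<open>g\<close> the integrals below exist for almost every \<open>x\<close>; at the remaining
  points the Bochner integral has the default value 0, which no almost-everywhere statement sees.
\<close>

definition hartley_conv :: "(real \<Rightarrow> complex) \<Rightarrow> (real \<Rightarrow> complex) \<Rightarrow> real \<Rightarrow> complex" where
  "hartley_conv f g x =
     complex_of_real (1 / (2 * sqrt (2 * pi))) *
     (LINT y|lebesgue. f y * (g (x + y) + g (x - y) + g (- x + y) - g (- x - y)))"

definition hartley_fourier_conv :: "(real \<Rightarrow> complex) \<Rightarrow> (real \<Rightarrow> complex) \<Rightarrow> real \<Rightarrow> complex" where
  "hartley_fourier_conv f g x =
     complex_of_real (1 / (2 * sqrt (2 * pi))) *
     (LINT y|lebesgue. g y * (f (x + y) + f (x - y) + \<i> * f (- x - y) - \<i> * f (- x + y)))"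

definition is_L1_solution ::
  "(real \<Rightarrow> complex) \<Rightarrow> (real \<Rightarrow> complex) \<Rightarrow> (real \<Rightarrow> complex) \<Rightarrow> bool" where
  "is_L1_solution \<phi> \<xi> f \<longleftrightarrow>
     f \<in> L1 \<and>
     (AE x in lebesgue. f x + hartley_conv f \<phi> x = hartley_fourier_conv \<phi> \<xi> x)"

definition is_resolvent_kernel :: "(real \<Rightarrow> complex) \<Rightarrow> (real \<Rightarrow> complex) \<Rightarrow> bool" where
  "is_resolvent_kernel \<phi> l \<longleftrightarrow>
     l \<in> L1 \<and> (\<forall>y. hartley_H1 l y = hartley_H1 \<phi> y / (1 + hartley_H1 \<phi> y))"

end

theory Submission
  imports Defs "HOL-Probability.Levy" "HOL-Real_Asymp.Real_Asymp"
begin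

text \<open>
  Write \<open>F f (w)\<close> for the Fourier integral \<open>fourier f w\<close> of an integrable \<open>f\<close>. The Hartley
  kernel is \<open>cos t + sin t = (1 - \<i>) / 2 * cis t + (1 + \<i>) / 2 * cis (- t)\<close>, so \<open>H\<^sub>1 f (y)\<close> is a
  combination of \<open>F f (y)\<close> and \<open>F f (- y)\<close>, and this combination can be inverted. In terms of \<open>F\<close>
  one checks by algebra that the Hartley convolution is multiplicative,
  \<open>H\<^sub>1 (f * g) = H\<^sub>1 f H\<^sub>1 g\<close>, and that the Hartley-Fourier convolution satisfies
  \<open>H\<^sub>1 (f * g) (y) = H\<^sub>1 f (y) F g (- y) / sqrt (2 \<pi>)\<close>. Since \<open>H\<^sub>1\<close> is injective on \<open>L\<^sub>1\<close>, the integral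
  equation is equivalent to the pointwise identity
  \<open>H\<^sub>1 f (y) = H\<^sub>1 \<phi> (y) / (1 + H\<^sub>1 \<phi> (y)) * F \<xi> (- y) / sqrt (2 \<pi>)\<close>. If \<open>l\<close> is the resolvent kernel,
  the right-hand side is the Hartley transform of the Hartley-Fourier convolution of \<open>l\<close> and \<open>\<xi>\<close>;
  this gives existence, uniqueness and the formula for the solution, and the norm estimate is
  Young's inequality for the four convolutions involved.
  
  The analytic heart is the existence of \<open>l\<close>, the Wiener-Levy theorem \<open>wiener_levy\<close>: if \<open>1 + F f\<close> has
  no zero then \<open>F f / (1 + F f)\<close> is again the Fourier transform of an integrable function. The proof
  adapts Newman's argument from Fourier series to the line. First, \<open>1 + F f\<close> is bounded away from \<open>0\<close>,
  say by \<open>\<delta>\<close>. Choose \<open>p\<close> close to \<open>f\<close> in \<open>L\<^sub>1\<close> such that \<open>F p\<close> is smooth with quadratic decay (lemma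
  \<open>integrable_tame_approximable\<close>), put \<open>P = 1 + F p\<close> and \<open>d = p - f\<close>, and expand
  \<open>1 / (1 + F f) = 1 / (P - F d) = (\<Sum>n. (F d) ^ n / P ^ (n + 1))\<close>. The \<open>n\<close>-th convolution power of
  \<open>d\<close> has norm at most \<open>(\<delta> / 3) ^ n\<close>, while \<open>1 / P ^ n - 1\<close> is the transform of a function of norm
  \<open>O (n\<^sup>2 (3 / (2 \<delta>)) ^ n)\<close>, because the \<open>L\<^sub>1\<close>-norm of an inverse Fourier transform is controlled by
  two derivatives of the transform (lemma \<open>tame_is_fourier\<close>). The powers combine to
  \<open>n\<^sup>2 / 2 ^ n\<close>, so the series of preimages converges in \<open>L\<^sub>1\<close>.
  
  Injectivity of \<open>F\<close>, and with it of \<open>H\<^sub>1\<close>, is Levy's uniqueness theorem for characteristic functions,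
  applied to the positive and negative parts of the real and imaginary parts.
\<close>

section \<open>Fourier transform and convolution of integrable functions\<close>

definition fourier :: "(real \<Rightarrow> complex) \<Rightarrow> real \<Rightarrow> complex" where
  "fourier f w = (LINT x|lborel. f x * cis (w * x))"

definition nrm1 :: "(real \<Rightarrow> complex) \<Rightarrow> real" where
  "nrm1 f = (LINT x|lborel. norm (f x))"

lemma cis_measurable [measurable]: "cis \<in> borel_measurable borel"
  by (intro borel_measurable_continuous_onI continuous_intros)

lemma integrable_mult_cis:
  fixes f :: "real \<Rightarrow> complex"
  assumes "integrable lborel f"
  shows "integrable lborel (\<lambda>x. f x * cis (w * x))"
proof -
  have [measurable]: "f \<in> borel_measurable lborel" using assms by auto
  show ?thesis
    by (rule Bochner_Integration.integrable_bound[OF assms]) (auto simp: norm_mult)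
qed

lemma fourier_add:
  assumes "integrable lborel f" "integrable lborel g"
  shows "fourier (\<lambda>x. f x + g x) w = fourier f w + fourier g w"
  unfolding fourier_def distrib_right
  using assms by (intro Bochner_Integration.integral_add integrable_mult_cis)

lemma fourier_diff:
  assumes "integrable lborel f" "integrable lborel g"
  shows "fourier (\<lambda>x. f x - g x) w = fourier f w - fourier g w"
  unfolding fourier_def left_diff_distrib
  using assms by (intro Bochner_Integration.integral_diff integrable_mult_cis)

lemma fourier_cmult: "fourier (\<lambda>x. c * f x) w = c * fourier f w"
  by (simp add: fourier_def mult.assoc)

lemma fourier_zero [simp]: "fourier (\<lambda>x. 0) w = 0"
  by (simp add: fourier_def)

lemma nrm1_nonneg: "0 \<le> nrm1 f"
  by (simp add: nrm1_def)

lemma norm_fourier_le: "norm (fourier f w) \<le> nrm1 f"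
proof -
  have "norm (fourier f w) \<le> (LINT x|lborel. norm (f x * cis (w * x)))"
    unfolding fourier_def by (rule integral_norm_bound)
  also have "\<dots> = nrm1 f" by (simp add: norm_mult nrm1_def)
  finally show ?thesis .
qed

lemma nrm1_triangle:
  assumes "integrable lborel f" "integrable lborel g"
  shows "nrm1 (\<lambda>x. f x + g x) \<le> nrm1 f + nrm1 g"
proof -
  have "nrm1 (\<lambda>x. f x + g x) \<le> (LINT x|lborel. norm (f x) + norm (g x))"
    unfolding nrm1_def using assms by (intro integral_mono) (auto intro: norm_triangle_ineq)
  then show ?thesis using assms by (simp add: nrm1_def)
qed

lemma nrm1_cmult: "nrm1 (\<lambda>x. c * f x) = norm c * nrm1 f"
  by (simp add: nrm1_def norm_mult)

lemma continuous_fourier: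
  assumes "integrable lborel f"
  shows "continuous_on UNIV (fourier f)"
proof (rule continuous_at_imp_continuous_on, rule ballI)
  fix w :: real
  have [measurable]: "f \<in> borel_measurable borel" using assms by auto
  show "isCont (fourier f) w"
    unfolding continuous_at_sequentially comp_def fourier_def
  proof (intro allI impI)
    fix u assume u: "u \<longlonglongrightarrow> w"
    show "(\<lambda>n. LINT x|lborel. f x * cis (u n * x)) \<longlonglongrightarrow> (LINT x|lborel. f x * cis (w * x))"
    proof (rule integral_dominated_convergence[where w="\<lambda>x. norm (f x)"])
      show "AE x in lborel. (\<lambda>n. f x * cis (u n * x)) \<longlonglongrightarrow> f x * cis (w * x)"
        using u by (auto intro!: tendsto_intros)
    qed (use assms in \<open>auto simp: norm_mult\<close>)
  qed
qed

text \<open>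
  With \<open>s\<close> and \<open>t\<close> ranging over \<open>1\<close> and \<open>-1\<close>, both generalized convolutions of the theorem are
  linear combinations of these integrals; the ordinary convolution is the case \<open>s = 1\<close>, \<open>t = -1\<close>.
\<close>

definition twisted_conv ::
    "real \<Rightarrow> real \<Rightarrow> (real \<Rightarrow> complex) \<Rightarrow> (real \<Rightarrow> complex) \<Rightarrow> real \<Rightarrow> complex" where
  "twisted_conv s t f g x = (LINT y|lborel. g y * f (s * x + t * y))"

context
  fixes s t :: real and f g :: "real \<Rightarrow> complex"
  assumes s: "\<bar>s\<bar> = 1"
    and f: "integrable lborel f" and g: "integrable lborel g"
begin

private lemma meas [measurable]: "f \<in> borel_measurable borel" "g \<in> borel_measurable borel"
  using f g by auto

private lemma sub:
  fixes h :: "real \<Rightarrow> 'b::{banach, second_countable_topology}"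
  shows "(LINT x|lborel. h (s * x + c)) = (LINT x|lborel. h x)"
  using lborel_integral_real_affine[of s h c] s by (auto simp: add.commute)

private lemma f_affine: "integrable lborel (\<lambda>x. f (s * x + c))"
  using lborel_integrable_real_affine[OF f, of s c] s by (auto simp: add.commute)

lemma twisted_conv_integrable_pair:
  "integrable (lborel \<Otimes>\<^sub>M lborel) (\<lambda>(y,x). g y * f (s * x + t * y))"
proof (rule lborel_pair.Fubini_integrable)
  show "(\<lambda>(y,x). g y * f (s * x + t * y)) \<in> borel_measurable (lborel \<Otimes>\<^sub>M lborel)"
    by measurable
  have "(\<lambda>y. LINT x|lborel. norm (g y * f (s * x + t * y))) = (\<lambda>y. norm (g y) * nrm1 f)"
    using sub[of "\<lambda>x. norm (f x)"] by (simp add: norm_mult nrm1_def)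
  then show "integrable lborel (\<lambda>y. LINT x|lborel. norm (case (y, x) of (y, x) \<Rightarrow> g y * f (s * x + t * y)))"
    using g by simp
  show "AE y in lborel. integrable lborel (\<lambda>x. case (y, x) of (y, x) \<Rightarrow> g y * f (s * x + t * y))"
    using f_affine by simp
qed

private lemma pair':
  "integrable (lborel \<Otimes>\<^sub>M lborel) (\<lambda>(x,y). g y * f (s * x + t * y))"
  using lborel_pair.integrable_product_swap[OF twisted_conv_integrable_pair]
  by (simp add: case_prod_unfold)

lemma twisted_conv_integrable: "integrable lborel (twisted_conv s t f g)"
  using lborel_pair.integrable_fst'[OF pair'] by (simp add: twisted_conv_def[abs_def])

lemma twisted_conv_AE:
  "AE x in lborel. integrable lborel (\<lambda>y. g y * f (s * x + t * y))"
  using lborel_pair.AE_integrable_fst'[OF pair'] by simp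

lemma nrm1_twisted_conv: "nrm1 (twisted_conv s t f g) \<le> nrm1 f * nrm1 g"
proof -
  have i: "integrable (lborel \<Otimes>\<^sub>M lborel) (\<lambda>(x,y). norm (g y * f (s * x + t * y)))"
    using integrable_norm[OF pair'] by (simp add: case_prod_unfold)
  have "nrm1 (twisted_conv s t f g) \<le> (LINT x|lborel. LINT y|lborel. norm (g y * f (s * x + t * y)))"
    unfolding nrm1_def
  proof (rule integral_mono)
    show "integrable lborel (\<lambda>x. norm (twisted_conv s t f g x))"
      using twisted_conv_integrable by simp
    show "integrable lborel (\<lambda>x. LINT y|lborel. norm (g y * f (s * x + t * y)))"
      using lborel_pair.integrable_fst'[OF i] by simp
  qed (simp add: twisted_conv_def)
  also have "\<dots> = (LINT y|lborel. LINT x|lborel. norm (g y * f (s * x + t * y)))"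
    by (rule lborel_pair.Fubini_integral[symmetric, OF i])
  also have "\<dots> = (LINT y|lborel. norm (g y) * nrm1 f)"
    using sub[of "\<lambda>x. norm (f x)"] by (simp add: norm_mult nrm1_def)
  also have "\<dots> = nrm1 f * nrm1 g" by (simp add: nrm1_def)
  finally show ?thesis .
qed

text \<open>
  Fubini's theorem and the substitution \<open>u = s * x + t * y\<close>, whose inverse is \<open>x = s * (u - t * y)\<close>
  because \<open>s\<^sup>2 = 1\<close>, separate the double integral.
\<close>

lemma fourier_twisted_conv:
  "fourier (twisted_conv s t f g) w = fourier f (s * w) * fourier g (- s * t * w)"
proof -
  have i: "integrable (lborel \<Otimes>\<^sub>M lborel) (\<lambda>(x,y). g y * f (s * x + t * y) * cis (w * x))"
    by (rule Bochner_Integration.integrable_bound[OF pair']) (auto simp: norm_mult)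
  have ss: "s * s = 1" using s by (auto simp: abs_if split: if_splits)
  have "fourier (twisted_conv s t f g) w
      = (LINT x|lborel. LINT y|lborel. g y * f (s * x + t * y) * cis (w * x))"
    by (simp add: fourier_def twisted_conv_def)
  also have "\<dots> = (LINT y|lborel. LINT x|lborel. g y * f (s * x + t * y) * cis (w * x))"
    by (rule lborel_pair.Fubini_integral[symmetric, OF i])
  also have "\<dots> = (LINT y|lborel. g y * cis (- s * t * w * y) * fourier f (s * w))"
  proof (rule Bochner_Integration.integral_cong[OF refl])
    fix y
    have "cis (w * x) = cis (- s * t * w * y) * cis (s * w * (s * x + t * y))" for x
    proof -
      have "- s * t * w * y + s * w * (s * x + t * y) = (s * s) * (w * x)"
        by (simp add: algebra_simps)
      then show ?thesis by (simp only: cis_mult ss mult_1)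
    qed
    then have "(LINT x|lborel. g y * f (s * x + t * y) * cis (w * x))
        = (LINT x|lborel. g y * cis (- s * t * w * y) * (f (s * x + t * y) * cis (s * w * (s * x + t * y))))"
      by (simp add: mult_ac)
    also have "\<dots> = g y * cis (- s * t * w * y) * (LINT x|lborel. f (s * x + t * y) * cis (s * w * (s * x + t * y)))"
      by simp
    also have "(LINT x|lborel. f (s * x + t * y) * cis (s * w * (s * x + t * y))) = fourier f (s * w)"
      unfolding fourier_def by (rule sub)
    finally show "(LINT x|lborel. g y * f (s * x + t * y) * cis (w * x))
        = g y * cis (- s * t * w * y) * fourier f (s * w)" .
  qed
  also have "\<dots> = fourier f (s * w) * fourier g (- s * t * w)"
    by (simp add: fourier_def mult.commute)
  finally show ?thesis .
qed

end

lemma fourier_reflect: "fourier (\<lambda>x. f (- x)) w = fourier f (- w)"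
  using lborel_integral_real_affine[of "-1" "\<lambda>x. f x * cis (-w * x)" 0]
  by (simp add: fourier_def)

lemma integrable_reflect:
  fixes f :: "real \<Rightarrow> complex"
  shows "integrable lborel f \<Longrightarrow> integrable lborel (\<lambda>x. f (- x))"
  using lborel_integrable_real_affine[of f "-1" 0] by simp

text \<open>
  This is completeness of \<open>L\<^sub>1\<close> in the form needed for the Neumann series: the pointwise sum of an
  absolutely convergent series exists almost everywhere and may be transformed term by term.
\<close>

lemma integrable_suminf_nrm1:
  assumes T: "\<And>n. integrable lborel (T n)" and sm: "summable (\<lambda>n. nrm1 (T n))"
  obtains m where "integrable lborel m" "\<And>w. (\<lambda>n. fourier (T n) w) sums fourier m w"
proof -
  have [measurable]: "T n \<in> borel_measurable borel" for n using T[of n] by auto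
  have "(\<integral>\<^sup>+x. (\<Sum>n. ennreal (norm (T n x))) \<partial>lborel) = (\<Sum>n. \<integral>\<^sup>+x. norm (T n x) \<partial>lborel)"
    by (rule nn_integral_suminf) auto
  also have "\<dots> = (\<Sum>n. ennreal (nrm1 (T n)))"
    using T by (simp add: nn_integral_eq_integral nrm1_def)
  also have "\<dots> \<noteq> \<infinity>"
    using suminf_ennreal2[OF nrm1_nonneg sm] by simp
  finally have "AE x in lborel. (\<Sum>n. ennreal (norm (T n x))) \<noteq> \<infinity>"
    by (intro nn_integral_PInf_AE) auto
  then have ae: "AE x in lborel. summable (\<lambda>n. norm (T n x))"
    by eventually_elim (auto intro: summable_suminf_not_top)
  have mi: "integrable lborel (\<lambda>x. \<Sum>n. T n x)"
    by (rule integrable_suminf[OF T ae]) (use sm in \<open>simp add: nrm1_def\<close>)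
  have "(\<lambda>n. fourier (T n) w) sums fourier (\<lambda>x. \<Sum>n. T n x) w" for w
  proof -
    have "(\<lambda>n. fourier (T n) w) sums (LINT x|lborel. (\<Sum>n. T n x * cis (w * x)))"
      unfolding fourier_def
      by (rule sums_integral[OF integrable_mult_cis[OF T]])
        (use ae sm in \<open>simp_all add: norm_mult nrm1_def\<close>)
    also have "(LINT x|lborel. (\<Sum>n. T n x * cis (w * x))) = fourier (\<lambda>x. \<Sum>n. T n x) w"
      unfolding fourier_def
    proof (rule integral_cong_AE)
      show "AE x in lborel. (\<Sum>n. T n x * cis (w * x)) = (\<Sum>n. T n x) * cis (w * x)"
        using ae by eventually_elim (simp add: suminf_mult2[OF summable_norm_cancel])
    qed measurable
    finally show ?thesis .
  qed
  with mi show ?thesis by (rule that)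
qed

section \<open>Fourier inversion for functions of quadratic decay\<close>

lemma integrable_inverse_one_plus_square: "integrable lborel (\<lambda>y::real. 1 / (1 + y\<^sup>2))"
  and integral_inverse_one_plus_square: "(LINT y|lborel. 1 / (1 + (y::real)\<^sup>2)) = pi"
  using integrable_inverse_1_plus_square LBINT_inverse_1_plus_square
  by (simp_all add: set_integrable_def interval_lebesgue_integral_def set_lebesgue_integral_def
      inverse_eq_divide)

lemma integrable_quadratic_decay:
  fixes Q :: "real \<Rightarrow> complex"
  assumes c: "continuous_on UNIV Q" and b: "\<And>y. norm (Q y) \<le> K / (1 + y\<^sup>2)"
  shows "integrable lborel Q" and "nrm1 Q \<le> K * pi"
proof -
  have [measurable]: "Q \<in> borel_measurable borel"
    using c by (rule borel_measurable_continuous_onI)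
  have i: "integrable lborel (\<lambda>y::real. K / (1 + y\<^sup>2))"
    using integrable_mult_right[OF integrable_inverse_one_plus_square, of K] by simp
  show "integrable lborel Q"
    by (rule Bochner_Integration.integrable_bound[OF i]) (auto intro!: always_eventually order_trans[OF b] divide_right_mono)
  then have "nrm1 Q \<le> (LINT y|lborel. K / (1 + y\<^sup>2))"
    unfolding nrm1_def using b by (intro integral_mono i) auto
  also have "\<dots> = K * pi"
    using integral_inverse_one_plus_square
      integral_mult_right_zero[of lborel K "\<lambda>y. 1 / (1 + y\<^sup>2)"] by simp
  finally show "nrm1 Q \<le> K * pi" .
qed

lemma quadratic_decay_tendsto:
  fixes Q :: "real \<Rightarrow> complex"
  assumes b: "\<And>y. norm (Q y) \<le> K / (1 + y\<^sup>2)"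
  shows "(Q \<longlongrightarrow> 0) at_top" "(Q \<longlongrightarrow> 0) at_bot"
proof -
  show "(Q \<longlongrightarrow> 0) at_top"
    by (rule Lim_null_comparison[OF always_eventually[OF allI[OF b]]]) real_asymp
  show "(Q \<longlongrightarrow> 0) at_bot"
    by (rule Lim_null_comparison[OF always_eventually[OF allI[OF b]]]) real_asymp
qed

lemma cis_has_vector_derivative:
  "((\<lambda>y. cis (w * y)) has_vector_derivative (\<i> * of_real w * cis (w * x))) (at x within A)"
  by (auto intro!: derivative_eq_intros simp: has_vector_derivative_complex_iff)

lemma fourier_derivative:
  assumes d: "\<And>y. (Q has_vector_derivative Q1 y) (at y)"
    and c: "continuous_on UNIV Q1"
    and b: "\<And>y. norm (Q y) \<le> K / (1 + y\<^sup>2)" and b1: "\<And>y. norm (Q1 y) \<le> K / (1 + y\<^sup>2)"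
  shows "fourier Q1 w = - \<i> * of_real w * fourier Q w"
proof -
  have c0: "continuous_on UNIV Q"
    using d by (auto intro!: continuous_at_imp_continuous_on has_vector_derivative_continuous)
  note i0 = integrable_mult_cis[OF integrable_quadratic_decay(1)[OF c0 b], of w]
  note i1 = integrable_mult_cis[OF integrable_quadratic_decay(1)[OF c b1], of w]
  let ?D = "\<lambda>y. Q1 y * cis (w * y) + \<i> * of_real w * (Q y * cis (w * y))"
  have i: "integrable lborel ?D" using i0 i1 by auto
  have "(LBINT y=-\<infinity>..\<infinity>. ?D y) = 0 - 0"
  proof (rule interval_integral_FTC_integrable)
    show "((\<lambda>y. Q y * cis (w * y)) has_vector_derivative ?D x) (at x)" for x
      using has_vector_derivative_mult[OF d[of x] cis_has_vector_derivative[where w=w and x=x and A=UNIV]]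
      by (simp add: algebra_simps)
    show "isCont ?D x" for x
      using c c0 has_vector_derivative_continuous[OF cis_has_vector_derivative[where w=w and x=x and A=UNIV]]
      by (intro continuous_intros) (auto simp: continuous_on_eq_continuous_at)
    show "set_integrable lborel (einterval (- \<infinity>) \<infinity>) ?D"
      using i by (simp add: set_integrable_def)
    have bb: "norm (Q y * cis (w * y)) \<le> K / (1 + y\<^sup>2)" for y
      using b by (simp add: norm_mult)
    show "(((\<lambda>y. Q y * cis (w * y)) \<circ> real_of_ereal) \<longlongrightarrow> 0) (at_right (- \<infinity>))"
      "(((\<lambda>y. Q y * cis (w * y)) \<circ> real_of_ereal) \<longlongrightarrow> 0) (at_left \<infinity>)"
      using quadratic_decay_tendsto[OF bb] by (simp_all add: ereal_tendsto_simps)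
  qed simp
  then have "0 = (LINT y|lborel. ?D y)"
    by (simp add: interval_lebesgue_integral_def set_lebesgue_integral_def)
  also have "\<dots> = fourier Q1 w + \<i> * of_real w * fourier Q w"
    unfolding fourier_def using i0 i1 by simp
  finally show ?thesis by (simp add: eq_neg_iff_add_eq_0)
qed

lemma integral_gaussian_cis:
  "(LINT x|lborel. of_real (std_normal_density x) * cis (a * x)) = of_real (exp (- a\<^sup>2 / 2))"
proof -
  have "char std_normal_distribution a
      = (LINT x|lborel. std_normal_density x *\<^sub>R iexp (a * x))"
    unfolding char_def by (rule integral_density) auto
  then show ?thesis
    by (simp add: char_std_normal_distribution scaleR_conv_of_real cis_conv_exp)
qed

lemma integrable_gaussian: "integrable lborel (\<lambda>x. complex_of_real (std_normal_density x))"
  by (intro integrable_of_real integrable_normal_density) auto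

text \<open>
  Gaussian summation: after insertion of a factor \<open>exp (- (x / N)\<^sup>2 / 2)\<close> the order of integration can
  be exchanged, and the inner integral is an explicit Gaussian centred at \<open>t\<close> of width \<open>1 / N\<close>. As \<open>N\<close>
  grows, one side tends to \<open>fourier q t\<close> and the other to \<open>Q t\<close>.
\<close>

lemma fourier_inversion:
  assumes c: "continuous_on UNIV Q" and b: "\<And>y. norm (Q y) \<le> K / (1 + y\<^sup>2)"
    and q_def: "\<And>x. q x = fourier Q (- x) / of_real (2 * pi)"
    and q: "integrable lborel q"
  shows "fourier q t = Q t"
proof -
  have Q: "integrable lborel Q" by (rule integrable_quadratic_decay[OF c b])
  have [measurable]: "Q \<in> borel_measurable borel" "q \<in> borel_measurable borel" using Q q by auto
  have QK: "norm (Q y) \<le> K" for y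
  proof -
    have "0 \<le> K" using b[of 0] norm_ge_zero[of "Q 0"] by (simp del: norm_ge_zero)
    then have "K / (1 + y\<^sup>2) \<le> K / 1" by (intro divide_left_mono) (auto simp: add_pos_nonneg)
    then show ?thesis using b[of y] by simp
  qed
  \<comment> \<open>The Gaussian of width \<open>n + 1\<close> normalised to the value \<open>1\<close> at the origin.\<close>
  define k where "k n x = std_normal_density (x / real (Suc n)) * sqrt (2 * pi)" for n x
  have k: "k n x = exp (- (x / real (Suc n))\<^sup>2 / 2)" for n x
    by (simp add: k_def std_normal_density_def)
  have k_le: "norm (k n x) \<le> 1" for n x by (simp add: k)
  have ki: "integrable lborel (k n)" for n
    using lborel_integrable_real_affine[of std_normal_density "1 / Suc n" 0]
      integrable_normal_density[of 1 0]
    unfolding k_def by simp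
  have [measurable]: "k n \<in> borel_measurable borel" for n using ki[of n] by auto
  have kc: "(LINT x|lborel. of_real (k n x) * cis (a * x))
      = of_real (Suc n * sqrt (2 * pi) * exp (- (a * Suc n)\<^sup>2 / 2))" for n and a :: real
  proof -
    have "(LINT x|lborel. of_real (k n x) * cis (a * x))
      = Suc n *\<^sub>R (LINT v|lborel. of_real (k n (Suc n * v)) * cis (a * (Suc n * v)))"
      using lborel_integral_real_affine[of "real (Suc n)" "\<lambda>x. of_real (k n x) * cis (a * x)" 0]
      by (simp del: of_nat_Suc)
    also have "(\<lambda>v::real. of_real (k n (Suc n * v)) * cis (a * (Suc n * v)))
      = (\<lambda>v. of_real (sqrt (2 * pi)) * (of_real (std_normal_density v) * cis ((a * Suc n) * v)))"
      by (simp add: k_def mult_ac del: of_nat_Suc)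
    finally show ?thesis
      unfolding integral_mult_right_zero integral_gaussian_cis scaleR_conv_of_real
      by (simp only: of_real_mult mult.assoc)
  qed
  have key: "(LINT x|lborel. q x * cis (t * x) * of_real (k n x))
      = (LINT u|lborel. Q (t + u / Suc n) * of_real (std_normal_density u))" for n
  proof -
    have i: "integrable (lborel \<Otimes>\<^sub>M lborel) (\<lambda>(x,y). Q y * cis (- x * y) * cis (t * x) * of_real (k n x))"
    proof (rule lborel_pair.Fubini_integrable)
      show "integrable lborel (\<lambda>x. LINT y|lborel.
          norm (case (x, y) of (x, y) \<Rightarrow> Q y * cis (- x * y) * cis (t * x) * of_real (k n x)))"
        using ki[of n] by (simp add: norm_mult)
      show "AE x in lborel. integrable lborel
          (\<lambda>y. case (x, y) of (x, y) \<Rightarrow> Q y * cis (- x * y) * cis (t * x) * of_real (k n x))"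
        using integrable_mult_cis[OF Q, of "- x" for x]
        by (intro always_eventually allI) (simp add: integrable_mult_left)
    qed measurable
    have "of_real (2 * pi) * (LINT x|lborel. q x * cis (t * x) * of_real (k n x))
      = (LINT x|lborel. (LINT y|lborel. Q y * cis (- x * y) * cis (t * x) * of_real (k n x)))"
      unfolding integral_mult_right_zero[symmetric]
      by (rule Bochner_Integration.integral_cong) (simp_all add: q_def fourier_def)
    also have "\<dots> = (LINT y|lborel. (LINT x|lborel. Q y * cis (- x * y) * cis (t * x) * of_real (k n x)))"
      by (rule lborel_pair.Fubini_integral[symmetric, OF i])
    also have "\<dots> = (LINT y|lborel. Q y * of_real (Suc n * sqrt (2 * pi) * exp (- ((t - y) * Suc n)\<^sup>2 / 2)))"
    proof (rule Bochner_Integration.integral_cong[OF refl])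
      fix y
      have "(\<lambda>x. Q y * cis (- x * y) * cis (t * x) * of_real (k n x))
        = (\<lambda>x. Q y * (of_real (k n x) * cis ((t - y) * x)))"
        by (simp add: fun_eq_iff mult_ac cis_mult algebra_simps)
      then show "(LINT x|lborel. Q y * cis (- x * y) * cis (t * x) * of_real (k n x))
        = Q y * of_real (Suc n * sqrt (2 * pi) * exp (- ((t - y) * Suc n)\<^sup>2 / 2))"
        using kc[of n "t - y"] by simp
    qed
    also have "\<dots> = (1 / Suc n) *\<^sub>R (LINT u|lborel. Q (t + u / Suc n)
        * of_real (Suc n * sqrt (2 * pi) * exp (- u\<^sup>2 / 2)))"
      using lborel_integral_real_affine[of "1 / Suc n"
          "\<lambda>y. Q y * of_real (Suc n * sqrt (2 * pi) * exp (- ((t - y) * Suc n)\<^sup>2 / 2))" t]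
      by (simp del: of_nat_Suc)
    also have "(\<lambda>u. Q (t + u / Suc n) * of_real (Suc n * sqrt (2 * pi) * exp (- u\<^sup>2 / 2)))
      = (\<lambda>u. of_real (Suc n * (2 * pi)) * (Q (t + u / Suc n) * of_real (std_normal_density u)))"
    proof
      fix u :: real
      have "Suc n * sqrt (2 * pi) * exp (- u\<^sup>2 / 2) = Suc n * (2 * pi) * std_normal_density u"
      proof -
        have "c * c * (1 / c * e) = c * e" for c e :: real by simp
        from this[of "sqrt (2 * pi)"]
        have "2 * pi * std_normal_density u = sqrt (2 * pi) * exp (- u\<^sup>2 / 2)"
          by (simp add: std_normal_density_def)
        then show ?thesis by (simp only: mult.assoc)
      qed
      then show "Q (t + u / Suc n) * of_real (Suc n * sqrt (2 * pi) * exp (- u\<^sup>2 / 2))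
        = of_real (Suc n * (2 * pi)) * (Q (t + u / Suc n) * of_real (std_normal_density u))"
        by (simp only: of_real_mult mult_ac)
    qed
    finally show ?thesis
      by (simp add: scaleR_conv_of_real del: of_nat_Suc)
  qed
  have "(\<lambda>n. LINT x|lborel. q x * cis (t * x) * of_real (k n x)) \<longlonglongrightarrow> (LINT x|lborel. q x * cis (t * x) * of_real 1)"
  proof (rule integral_dominated_convergence[where w="\<lambda>x. norm (q x)"])
    have over_n: "(\<lambda>n. x / real (Suc n)) \<longlonglongrightarrow> 0" for x
      by (rule LIMSEQ_Suc[OF lim_const_over_n])
    have "(\<lambda>n. exp (- (x / real (Suc n))\<^sup>2 / 2)) \<longlonglongrightarrow> exp (- 0\<^sup>2 / 2)" for x :: real
      by (intro tendsto_intros over_n) simp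
    then have "(\<lambda>n. k n x) \<longlonglongrightarrow> 1" for x by (simp add: k)
    then show "AE x in lborel. (\<lambda>n. q x * cis (t * x) * of_real (k n x)) \<longlonglongrightarrow> q x * cis (t * x) * of_real 1"
      by (intro always_eventually allI tendsto_intros)
    show "AE x in lborel. norm (q x * cis (t * x) * of_real (k n x)) \<le> norm (q x)" for n
      using k_le[of n] by (auto simp: norm_mult intro!: mult_left_le)
  qed (use q in auto)
  moreover
  have "(\<lambda>n. LINT u|lborel. Q (t + u / Suc n) * of_real (std_normal_density u))
      \<longlonglongrightarrow> (LINT u|lborel. Q t * of_real (std_normal_density u))"
  proof (rule integral_dominated_convergence[where w="\<lambda>u. K * std_normal_density u"])
    have "(\<lambda>n. Q (t + u / Suc n)) \<longlonglongrightarrow> Q t" for u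
    proof (rule isCont_tendsto_compose[of _ Q])
      show "isCont Q t" using c by (simp add: continuous_on_eq_continuous_at)
      show "(\<lambda>n. t + u / real (Suc n)) \<longlonglongrightarrow> t"
        using tendsto_add[OF tendsto_const LIMSEQ_Suc[OF lim_const_over_n[of u]], of t] by simp
    qed
    then show "AE u in lborel. (\<lambda>n. Q (t + u / Suc n) * of_real (std_normal_density u))
        \<longlonglongrightarrow> Q t * of_real (std_normal_density u)"
      by (intro always_eventually allI tendsto_intros)
    show "AE u in lborel. norm (Q (t + u / Suc n) * of_real (std_normal_density u)) \<le> K * std_normal_density u" for n
      using QK by (auto simp: norm_mult intro!: mult_right_mono)
    show "integrable lborel (\<lambda>u. K * std_normal_density u)"
      by (intro integrable_mult_right integrable_normal_density) auto
  qed auto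
  moreover have "(LINT u|lborel. Q t * of_real (std_normal_density u)) = Q t"
    using integral_gaussian_cis[of 0] by simp
  ultimately show ?thesis
    unfolding key using LIMSEQ_unique by (fastforce simp: fourier_def)
qed

text \<open>
  Two derivatives of quadratic decay are what makes an inverse Fourier transform integrable with an
  explicit bound. The derivatives and the constant are arguments because the growth of the
  constant under the formation of powers is what the Wiener-Levy theorem depends on.
\<close>

definition tame :: "real \<Rightarrow> (real \<Rightarrow> complex) \<Rightarrow> (real \<Rightarrow> complex) \<Rightarrow> (real \<Rightarrow> complex) \<Rightarrow> bool" where
  "tame K Q Q1 Q2 \<longleftrightarrow>
     (\<forall>y. (Q has_vector_derivative Q1 y) (at y)) \<and> (\<forall>y. (Q1 has_vector_derivative Q2 y) (at y)) \<and>
     continuous_on UNIV Q2 \<and>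
     (\<forall>y. norm (Q y) \<le> K / (1 + y\<^sup>2) \<and> norm (Q1 y) \<le> K / (1 + y\<^sup>2) \<and> norm (Q2 y) \<le> K / (1 + y\<^sup>2))"

text \<open>
  The inverse transform \<open>q\<close> is bounded by the \<open>L\<^sub>1\<close>-norm of \<open>Q\<close>, and after two integrations by parts
  \<open>x\<^sup>2 q x\<close> is bounded by the \<open>L\<^sub>1\<close>-norm of \<open>Q''\<close>. So \<open>q\<close> itself has quadratic decay, is integrable,
  and the inversion formula applies to it.
\<close>

lemma tame_is_fourier:
  assumes "tame K Q Q1 Q2"
  obtains q where "integrable lborel q" "fourier q = Q" "nrm1 q \<le> K * pi"
proof -
  have d: "\<And>y. (Q has_vector_derivative Q1 y) (at y)" "\<And>y. (Q1 has_vector_derivative Q2 y) (at y)"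
    and c2: "continuous_on UNIV Q2"
    and b: "\<And>y. norm (Q y) \<le> K / (1 + y\<^sup>2)" "\<And>y. norm (Q1 y) \<le> K / (1 + y\<^sup>2)"
      "\<And>y. norm (Q2 y) \<le> K / (1 + y\<^sup>2)"
    using assms by (auto simp: tame_def)
  have c: "continuous_on UNIV Q" "continuous_on UNIV Q1"
    using d by (auto intro!: continuous_at_imp_continuous_on has_vector_derivative_continuous)
  define q where "q x = fourier Q (- x) / of_real (2 * pi)" for x
  have qc: "continuous_on UNIV q"
    unfolding q_def
    by (intro continuous_intros continuous_on_compose2[OF continuous_fourier]
        integrable_quadratic_decay(1)[OF c(1) b(1)]) auto
  have qb: "norm (q x) \<le> K / (1 + x\<^sup>2)" for x
  proof -
    have "x\<^sup>2 * norm (fourier Q (- x)) = norm (fourier Q2 (- x))"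
      using fourier_derivative[OF d(1) c(2) b(1,2), of "-x"]
        fourier_derivative[OF d(2) c2 b(2,3), of "-x"]
      by (simp add: norm_mult power2_eq_square abs_mult_self_eq flip: mult.assoc)
    also have "\<dots> \<le> K * pi"
      using norm_fourier_le integrable_quadratic_decay(2)[OF c2 b(3)] by (rule order_trans)
    finally have "x\<^sup>2 * norm (fourier Q (- x)) \<le> K * pi" .
    moreover have "norm (fourier Q (- x)) \<le> K * pi"
      using norm_fourier_le integrable_quadratic_decay(2)[OF c(1) b(1)] by (rule order_trans)
    ultimately have "(1 + x\<^sup>2) * norm (fourier Q (- x)) \<le> 2 * pi * K"
      by (simp add: algebra_simps)
    moreover have "0 < 1 + x\<^sup>2" by (simp add: add_pos_nonneg)
    ultimately show ?thesis
      by (simp add: q_def norm_divide field_simps)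
  qed
  show ?thesis
  proof (rule that)
    show qi: "integrable lborel q" "nrm1 q \<le> K * pi"
      using integrable_quadratic_decay[OF qc qb] by auto
    show "fourier q = Q"
      using fourier_inversion[OF c(1) b(1) q_def qi(1)] by auto
  qed
qed

section \<open>Density of functions with tame transform\<close>

lemma tame_add:
  assumes "tame K F F1 F2" "tame L G G1 G2"
  shows "tame (K + L) (\<lambda>w. F w + G w) (\<lambda>w. F1 w + G1 w) (\<lambda>w. F2 w + G2 w)"
  using assms unfolding tame_def add_divide_distrib
  by (intro conjI allI has_vector_derivative_add continuous_on_add norm_triangle_mono) simp_all

text \<open>
  The factor \<open>4\<close> counts the terms of the second derivative under the product rule.
\<close>

lemma tame_mult:
  assumes d: "\<And>w. (H has_vector_derivative H1 w) (at w)" "\<And>w. (H1 has_vector_derivative H2 w) (at w)"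
    and c: "continuous_on UNIV H2"
    and B: "\<And>w. norm (H w) \<le> B" "\<And>w. norm (H1 w) \<le> B" "\<And>w. norm (H2 w) \<le> B"
    and G: "tame K G G1 G2"
  shows "tame (4 * B * K) (\<lambda>w. H w * G w) (\<lambda>w. H w * G1 w + H1 w * G w)
    (\<lambda>w. H w * G2 w + H1 w * G1 w + (H1 w * G1 w + H2 w * G w))"
  unfolding tame_def
proof (intro conjI allI)
  have g: "\<And>w. (G has_vector_derivative G1 w) (at w)" "\<And>w. (G1 has_vector_derivative G2 w) (at w)"
    "continuous_on UNIV G2"
    "\<And>w. norm (G w) \<le> K / (1 + w\<^sup>2)" "\<And>w. norm (G1 w) \<le> K / (1 + w\<^sup>2)" "\<And>w. norm (G2 w) \<le> K / (1 + w\<^sup>2)"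
    using G by (auto simp: tame_def)
  show "((\<lambda>w. H w * G w) has_vector_derivative H w * G1 w + H1 w * G w) (at w)" for w
    by (intro has_vector_derivative_mult d g)
  show "((\<lambda>w. H w * G1 w + H1 w * G w) has_vector_derivative
      H w * G2 w + H1 w * G1 w + (H1 w * G1 w + H2 w * G w)) (at w)" for w
    by (intro has_vector_derivative_mult has_vector_derivative_add d g)
  show "continuous_on UNIV (\<lambda>w. H w * G2 w + H1 w * G1 w + (H1 w * G1 w + H2 w * G w))"
    by (intro continuous_intros c g continuous_at_imp_continuous_on ballI
        has_vector_derivative_continuous[OF d(1)] has_vector_derivative_continuous[OF d(2)]
        has_vector_derivative_continuous[OF g(1)] has_vector_derivative_continuous[OF g(2)])
  have B0: "0 \<le> B" using B(1)[of 0] norm_ge_zero order_trans by blast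
  have m: "norm (x * y) \<le> B * (K / (1 + w\<^sup>2))" if "norm x \<le> B" "norm y \<le> K / (1 + w\<^sup>2)"
    for x y :: complex and w
    using that B0 unfolding norm_mult by (intro mult_mono) auto
  have e: "4 * B * K / (1 + w\<^sup>2) = B * (K / (1 + w\<^sup>2)) + B * (K / (1 + w\<^sup>2)) + (B * (K / (1 + w\<^sup>2)) + B * (K / (1 + w\<^sup>2)))" for w
    by simp
  have p: "0 \<le> B * (K / (1 + w\<^sup>2))" for w
    using m[OF B(1)[of w] g(4)[of w]] norm_ge_zero order_trans by blast
  show "norm (H w * G w) \<le> 4 * B * K / (1 + w\<^sup>2)" for w
    using m[OF B(1)[of w] g(4)[of w]] p[of w] unfolding e by linarith
  show "norm (H w * G1 w + H1 w * G w) \<le> 4 * B * K / (1 + w\<^sup>2)" for w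
    using norm_triangle_mono[OF m[OF B(1)[of w] g(5)[of w]] m[OF B(2)[of w] g(4)[of w]]] p[of w]
    unfolding e by linarith
  show "norm (H w * G2 w + H1 w * G1 w + (H1 w * G1 w + H2 w * G w)) \<le> 4 * B * K / (1 + w\<^sup>2)" for w
    unfolding e by (intro norm_triangle_mono m B g)
qed

lemma tame_cmult:
  assumes "tame K G G1 G2"
  shows "tame (norm c * K) (\<lambda>w. c * G w) (\<lambda>w. c * G1 w) (\<lambda>w. c * G2 w)"
proof -
  have g: "\<And>w. (G has_vector_derivative G1 w) (at w)" "\<And>w. (G1 has_vector_derivative G2 w) (at w)"
    "continuous_on UNIV G2"
    "\<And>w. norm (G w) \<le> K / (1 + w\<^sup>2)" "\<And>w. norm (G1 w) \<le> K / (1 + w\<^sup>2)" "\<And>w. norm (G2 w) \<le> K / (1 + w\<^sup>2)"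
    using assms by (auto simp: tame_def)
  have b: "norm (c * z) \<le> norm c * K / (1 + w\<^sup>2)" if "norm z \<le> K / (1 + w\<^sup>2)" for z :: complex and w
    using mult_left_mono[OF that, of "norm c"] by (simp add: norm_mult)
  show ?thesis
    unfolding tame_def
  proof (intro conjI allI)
    show "((\<lambda>w. c * G w) has_vector_derivative c * G1 w) (at w)"
      "((\<lambda>w. c * G1 w) has_vector_derivative c * G2 w) (at w)" for w
      by (rule has_vector_derivative_mult_right, rule g)+
    show "continuous_on UNIV (\<lambda>w. c * G2 w)"
      by (rule continuous_on_mult_left[OF g(3)])
  qed (rule b, rule g)+
qed

text \<open>
  Follows from the quadratic Taylor bound \<open>1 + u + u\<^sup>2 / 2 \<le> exp u\<close> at \<open>u = c w\<^sup>2\<close>.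
\<close>

lemma gaussian_decay:
  assumes "0 < (c::real)"
  shows "(1 + w\<^sup>2)\<^sup>2 * exp (- (c * w\<^sup>2)) \<le> 1 + 2 / c + 2 / c\<^sup>2"
proof -
  let ?M = "1 + 2 / c + 2 / c\<^sup>2" and ?u = "w\<^sup>2"
  have 1: "1 + c * ?u + (c * ?u)\<^sup>2 / 2 \<le> exp (c * ?u)"
    using assms by (intro exp_lower_Taylor_quadratic) auto
  have c: "2 \<le> ?M * c" "1 \<le> ?M * c\<^sup>2 / 2"
    using assms by (simp_all add: field_simps power2_eq_square)
  have "(1 + ?u)\<^sup>2 = 1 + 2 * ?u + 1 * ?u\<^sup>2" by (simp add: power2_eq_square algebra_simps)
  also have "\<dots> \<le> ?M + (?M * c) * ?u + (?M * c\<^sup>2 / 2) * ?u\<^sup>2"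
    using assms by (intro add_mono mult_right_mono c) auto
  also have "\<dots> = ?M * (1 + c * ?u + (c * ?u)\<^sup>2 / 2)"
    by (simp add: algebra_simps power2_eq_square)
  also have "\<dots> \<le> ?M * exp (c * ?u)"
    using assms by (intro mult_left_mono 1) auto
  finally show ?thesis by (simp add: exp_minus field_simps)
qed

text \<open>
  Each derivative is a Gaussian times a polynomial of degree at most two, hence at most a constant
  times \<open>(1 + w\<^sup>2) * exp (- c w\<^sup>2)\<close>, and \<open>gaussian_decay\<close> absorbs the polynomial.
\<close>

lemma tame_gaussian:
  assumes c: "0 < (c::real)"
  shows "\<exists>K. tame K (\<lambda>w. of_real (exp (- (c * w\<^sup>2)))) (\<lambda>w. of_real (- 2 * c * w * exp (- (c * w\<^sup>2))))
    (\<lambda>w. of_real ((4 * c\<^sup>2 * w\<^sup>2 - 2 * c) * exp (- (c * w\<^sup>2))))"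
proof -
  define A where "A = 1 + 2 * c + 4 * c\<^sup>2"
  let ?K = "A * (1 + 2 / c + 2 / c\<^sup>2)"
  have b: "norm (complex_of_real (z * exp (- (c * w\<^sup>2)))) \<le> ?K / (1 + w\<^sup>2)"
    if "\<bar>z\<bar> \<le> A * (1 + w\<^sup>2)" for z w :: real
  proof -
    have p: "0 < 1 + w\<^sup>2" by (simp add: add_pos_nonneg)
    have "(1 + w\<^sup>2) * norm (complex_of_real (z * exp (- (c * w\<^sup>2))))
        = (1 + w\<^sup>2) * (\<bar>z\<bar> * exp (- (c * w\<^sup>2)))"
      by (simp add: norm_mult)
    also have "\<dots> \<le> (1 + w\<^sup>2) * (A * (1 + w\<^sup>2) * exp (- (c * w\<^sup>2)))"
      using p that by (intro mult_left_mono mult_right_mono) auto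
    also have "\<dots> = A * ((1 + w\<^sup>2)\<^sup>2 * exp (- (c * w\<^sup>2)))" by (simp add: power2_eq_square)
    also have "\<dots> \<le> ?K"
      using c by (intro mult_left_mono gaussian_decay) (simp_all add: A_def add_nonneg_nonneg)
    finally show ?thesis unfolding pos_le_divide_eq[OF p] by (simp only: mult.commute)
  qed
  have z0: "\<bar>1\<bar> \<le> A * (1 + w\<^sup>2)" for w
    using c mult_mono[of 1 A 1 "1 + w\<^sup>2"] by (simp add: A_def)
  have z1: "\<bar>- 2 * c * w\<bar> \<le> A * (1 + w\<^sup>2)" for w
  proof -
    have "2 * \<bar>w\<bar> \<le> 1 + w\<^sup>2" using sum_squares_bound[of 1 "\<bar>w\<bar>"] by simp
    then have "c * (2 * \<bar>w\<bar>) \<le> A * (1 + w\<^sup>2)"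
      using c by (intro mult_mono) (auto simp: A_def)
    then show ?thesis using c by (simp add: abs_mult mult_ac)
  qed
  have z2: "\<bar>4 * c\<^sup>2 * w\<^sup>2 - 2 * c\<bar> \<le> A * (1 + w\<^sup>2)" for w
  proof -
    have "0 \<le> c\<^sup>2 * w\<^sup>2" "0 \<le> c * w\<^sup>2" "0 \<le> w\<^sup>2" "0 \<le> c\<^sup>2" using c by auto
    moreover have "A * (1 + w\<^sup>2) = 1 + 2 * c + 4 * c\<^sup>2 + w\<^sup>2 + 2 * (c * w\<^sup>2) + 4 * (c\<^sup>2 * w\<^sup>2)"
      by (simp add: A_def algebra_simps)
    moreover have "\<bar>4 * c\<^sup>2 * w\<^sup>2 - 2 * c\<bar> \<le> 4 * (c\<^sup>2 * w\<^sup>2) + 2 * c" using c calculation(1) by (simp add: abs_le_iff)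
    ultimately show ?thesis using c by linarith
  qed
  have "tame ?K (\<lambda>w. of_real (exp (- (c * w\<^sup>2)))) (\<lambda>w. of_real (- 2 * c * w * exp (- (c * w\<^sup>2))))
    (\<lambda>w. of_real ((4 * c\<^sup>2 * w\<^sup>2 - 2 * c) * exp (- (c * w\<^sup>2))))"
    unfolding tame_def
  proof (intro conjI allI)
    fix w
    show "((\<lambda>w. complex_of_real (exp (- (c * w\<^sup>2)))) has_vector_derivative
        of_real (- 2 * c * w * exp (- (c * w\<^sup>2)))) (at w)"
    proof (rule has_vector_derivative_of_real)
      show "((\<lambda>w. exp (- (c * w\<^sup>2))) has_real_derivative - 2 * c * w * exp (- (c * w\<^sup>2))) (at w)"
        by (auto intro!: derivative_eq_intros)
    qed
    show "((\<lambda>w. complex_of_real (- 2 * c * w * exp (- (c * w\<^sup>2)))) has_vector_derivative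
        of_real ((4 * c\<^sup>2 * w\<^sup>2 - 2 * c) * exp (- (c * w\<^sup>2)))) (at w)"
    proof (rule has_vector_derivative_of_real)
      show "((\<lambda>w. - 2 * c * w * exp (- (c * w\<^sup>2))) has_real_derivative
          (4 * c\<^sup>2 * w\<^sup>2 - 2 * c) * exp (- (c * w\<^sup>2))) (at w)"
        by (auto intro!: derivative_eq_intros) (simp add: power2_eq_square algebra_simps)
    qed
    show "norm (complex_of_real (exp (- (c * w\<^sup>2)))) \<le> ?K / (1 + w\<^sup>2)"
      using b[OF z0[of w]] unfolding mult_1 .
    show "norm (complex_of_real (- 2 * c * w * exp (- (c * w\<^sup>2)))) \<le> ?K / (1 + w\<^sup>2)"
      by (rule b[OF z1])
    show "norm (complex_of_real ((4 * c\<^sup>2 * w\<^sup>2 - 2 * c) * exp (- (c * w\<^sup>2)))) \<le> ?K / (1 + w\<^sup>2)"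
      by (rule b[OF z2])
  next
    show "continuous_on UNIV (\<lambda>w. complex_of_real ((4 * c\<^sup>2 * w\<^sup>2 - 2 * c) * exp (- (c * w\<^sup>2))))"
      by (intro continuous_intros)
  qed
  then show ?thesis by blast
qed

text \<open>
  The transform of an interval is an integral over a compact set, so it can be differentiated under
  the integral sign; it decays only like \<open>1 / w\<close>, but its derivatives are bounded, which is enough
  once it is multiplied by the transform of a Gaussian.
\<close>

lemma fourier_indicator_interval_C2:
  fixes a b :: real
  defines "H \<equiv> fourier (indicator {a..b})"
  shows "\<exists>H1 H2 B. (\<forall>w. (H has_vector_derivative H1 w) (at w)) \<and>
    (\<forall>w. (H1 has_vector_derivative H2 w) (at w)) \<and> continuous_on UNIV H2 \<and>
    (\<forall>w. norm (H w) \<le> B \<and> norm (H1 w) \<le> B \<and> norm (H2 w) \<le> B)"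
proof -
  define I where "I k w = integral {a..b} (\<lambda>x. (\<i> * of_real x) ^ k * cis (w * x))" for k w
  have cc: "continuous_on A (\<lambda>x. (\<i> * of_real x) ^ k * cis (w * x))" for A k w
    by (intro continuous_intros)
  have d: "(I k has_vector_derivative I (Suc k) w) (at w)" for k w
    unfolding I_def cbox_interval[symmetric]
  proof (rule leibniz_rule_vector_derivative[where U=UNIV])
    fix w t
    have "((\<lambda>w. (\<i> * of_real t) ^ k * cis (t * w)) has_vector_derivative
        (\<i> * of_real t) ^ k * (\<i> * of_real t * cis (t * w))) (at w)"
      by (intro has_vector_derivative_mult_right cis_has_vector_derivative)
    then show "((\<lambda>w. (\<i> * of_real t) ^ k * cis (w * t)) has_vector_derivative
        (\<i> * of_real t) ^ Suc k * cis (w * t)) (at w within UNIV)"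
      by (simp add: mult_ac)
    show "(\<lambda>t. (\<i> * of_real t) ^ k * cis (w * t)) integrable_on cbox a b"
      by (intro integrable_continuous cc)
  next
    show "continuous_on (UNIV \<times> cbox a b) (\<lambda>(w, t). (\<i> * complex_of_real t) ^ Suc k * cis (w * t))"
      unfolding case_prod_unfold by (intro continuous_intros)
  qed auto
  have H: "H w = I 0 w" for w
  proof -
    have si: "set_integrable lborel {a..b} (\<lambda>x. cis (w * x))"
      by (intro borel_integrable_atLeastAtMost' continuous_intros)
    have "H w = (LINT x:{a..b}|lborel. cis (w * x))"
      unfolding H_def fourier_def set_lebesgue_integral_def
      by (intro Bochner_Integration.integral_cong) (auto simp: indicator_def)
    also have "\<dots> = I 0 w" unfolding I_def by (simp add: set_borel_integral_eq_integral(2)[OF si])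
    finally show ?thesis .
  qed
  have bd: "norm (I k w) \<le> integral {a..b} (\<lambda>x. \<bar>x\<bar> ^ k)" for k w
    unfolding I_def
    by (rule integral_norm_bound_integral)
      (auto intro!: integrable_continuous_real continuous_intros simp: norm_mult norm_power)
  let ?b = "\<lambda>k. integral {a..b} (\<lambda>x. \<bar>x\<bar> ^ k)"
  have b0: "0 \<le> ?b k" for k using bd[of k 0] norm_ge_zero order_trans by blast
  have "norm (I k w) \<le> ?b 0 + ?b 1 + ?b 2" if "k = 0 \<or> k = 1 \<or> k = 2" for k w
    using that bd[of k w] b0[of 0] b0[of 1] b0[of 2] by auto
  moreover have "continuous_on UNIV (I 2)"
    by (intro continuous_at_imp_continuous_on ballI has_vector_derivative_continuous[OF d])
  moreover have "H = I 0" using H by auto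
  ultimately show ?thesis
    using d[of 0] d[of 1]
    by (intro exI[of _ "I 1"] exI[of _ "I 2"] exI[of _ "?b 0 + ?b 1 + ?b 2"])
      (auto simp: numeral_2_eq_2)
qed

definition tame_approximable :: "(real \<Rightarrow> complex) \<Rightarrow> bool" where
  "tame_approximable f \<longleftrightarrow> integrable lborel f \<and>
     (\<forall>e>0. \<exists>p K S1 S2. integrable lborel p \<and> tame K (fourier p) S1 S2 \<and> nrm1 (\<lambda>x. f x - p x) < e)"

lemma tame_approximable_add:
  assumes f: "tame_approximable f" and g: "tame_approximable g"
  shows "tame_approximable (\<lambda>x. f x + g x)"
  unfolding tame_approximable_def
proof (intro conjI allI impI)
  have fi: "integrable lborel f" and gi: "integrable lborel g"
    using f g by (auto simp: tame_approximable_def)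
  then show "integrable lborel (\<lambda>x. f x + g x)" by simp
  fix e :: real assume "0 < e"
  then have e2: "e / 2 > 0" by simp
  from f[unfolded tame_approximable_def] e2 obtain p K S1 S2 where
    p: "integrable lborel p" "tame K (fourier p) S1 S2" "nrm1 (\<lambda>x. f x - p x) < e / 2" by blast
  from g[unfolded tame_approximable_def] e2 obtain q L T1 T2 where
    q: "integrable lborel q" "tame L (fourier q) T1 T2" "nrm1 (\<lambda>x. g x - q x) < e / 2" by blast
  have "fourier (\<lambda>x. p x + q x) = (\<lambda>w. fourier p w + fourier q w)"
    using p q by (auto simp: fourier_add)
  then have "tame (K + L) (fourier (\<lambda>x. p x + q x)) (\<lambda>w. S1 w + T1 w) (\<lambda>w. S2 w + T2 w)"
    using tame_add[OF p(2) q(2)] by simp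
  moreover have "nrm1 (\<lambda>x. f x + g x - (p x + q x)) < e"
    using nrm1_triangle[of "\<lambda>x. f x - p x" "\<lambda>x. g x - q x"] fi gi p q by (simp add: algebra_simps)
  moreover have "integrable lborel (\<lambda>x. p x + q x)" using p q by simp
  ultimately show "\<exists>p K S1 S2. integrable lborel p \<and> tame K (fourier p) S1 S2 \<and>
      nrm1 (\<lambda>x. f x + g x - p x) < e" by blast
qed

lemma tame_approximable_cmult:
  assumes f: "tame_approximable f"
  shows "tame_approximable (\<lambda>x. c * f x)"
  unfolding tame_approximable_def
proof (intro conjI allI impI)
  show "integrable lborel (\<lambda>x. c * f x)" using f by (auto simp: tame_approximable_def)
  fix e :: real assume e: "0 < e"
  then have "e / (norm c + 1) > 0" by (intro divide_pos_pos add_nonneg_pos) auto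
  from f[unfolded tame_approximable_def] this obtain p K S1 S2 where
    p: "integrable lborel p" "tame K (fourier p) S1 S2" "nrm1 (\<lambda>x. f x - p x) < e / (norm c + 1)"
    by blast
  have n0: "0 < norm c + 1" by (intro add_nonneg_pos) auto
  have "nrm1 (\<lambda>x. c * f x - c * p x) = norm c * nrm1 (\<lambda>x. f x - p x)"
    using nrm1_cmult[of c "\<lambda>x. f x - p x"] by (simp add: right_diff_distrib)
  also have "\<dots> \<le> (norm c + 1) * nrm1 (\<lambda>x. f x - p x)"
    by (intro mult_right_mono nrm1_nonneg) auto
  also have "\<dots> < e" using p(3) n0 by (simp add: field_simps)
  finally have "nrm1 (\<lambda>x. c * f x - c * p x) < e" .
  moreover have "tame (norm c * K) (fourier (\<lambda>x. c * p x)) (\<lambda>w. c * S1 w) (\<lambda>w. c * S2 w)"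
    using tame_cmult[OF p(2), of c] by (simp add: fourier_cmult[abs_def])
  ultimately show "\<exists>p K S1 S2. integrable lborel p \<and> tame K (fourier p) S1 S2 \<and>
      nrm1 (\<lambda>x. c * f x - p x) < e" using p(1) integrable_mult_right by blast
qed

lemma tame_approximable_limit:
  assumes s: "\<And>n. tame_approximable (s n)" and f [measurable]: "f \<in> borel_measurable borel"
    and lim: "AE x in lborel. (\<lambda>n. s n x) \<longlonglongrightarrow> f x"
    and g: "integrable lborel g"
    and b: "\<And>n x. norm (s n x) \<le> g x" and fb: "\<And>x. norm (f x) \<le> g x"
  shows "tame_approximable f"
proof -
  have si: "integrable lborel (s n)" for n using s by (auto simp: tame_approximable_def)
  then have [measurable]: "s n \<in> borel_measurable borel" for n
    by (metis borel_measurable_integrable measurable_lborel2)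
  have fi: "integrable lborel f"
    by (rule Bochner_Integration.integrable_bound[OF g]) (auto intro!: always_eventually order_trans[OF fb])
  have "(\<lambda>n. LINT x|lborel. norm (f x - s n x)) \<longlonglongrightarrow> (LINT x|(lborel::real measure). norm (0::complex))"
  proof (rule integral_dominated_convergence[where w="\<lambda>x. g x + g x"])
    show "AE x in lborel. (\<lambda>n. norm (f x - s n x)) \<longlonglongrightarrow> norm (0::complex)"
      using lim
    proof eventually_elim
      case (elim x)
      have "(\<lambda>n. norm (f x - s n x)) \<longlonglongrightarrow> norm (f x - f x)"
        by (intro tendsto_intros elim)
      then show ?case by simp
    qed
    show "AE x in lborel. norm (norm (f x - s n x)) \<le> g x + g x" for n
      unfolding real_norm_def abs_norm_cancel
      by (intro always_eventually allI order_trans[OF norm_triangle_ineq4 add_mono] b fb)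
  qed (use g in auto)
  then have lim0: "(\<lambda>n. nrm1 (\<lambda>x. f x - s n x)) \<longlonglongrightarrow> 0" by (simp add: nrm1_def)
  show ?thesis
    unfolding tame_approximable_def
  proof (intro conjI allI impI fi)
    fix e :: real assume "0 < e"
    then have e2: "e / 2 > 0" by simp
    from order_tendstoD(2)[OF lim0 e2] obtain n where n: "nrm1 (\<lambda>x. f x - s n x) < e / 2"
      by (auto dest: eventually_happens)
    from s[of n, unfolded tame_approximable_def] e2 obtain p K S1 S2 where
      p: "integrable lborel p" "tame K (fourier p) S1 S2" "nrm1 (\<lambda>x. s n x - p x) < e / 2" by blast
    have "nrm1 (\<lambda>x. f x - p x) < e"
      using nrm1_triangle[of "\<lambda>x. f x - s n x" "\<lambda>x. s n x - p x"] fi si p n by simp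
    with p show "\<exists>p K S1 S2. integrable lborel p \<and> tame K (fourier p) S1 S2 \<and>
      nrm1 (\<lambda>x. f x - p x) < e" by blast
  qed
qed

text \<open>
  The normal density of standard deviation \<open>1 / (n + 1)\<close>, used as an approximate identity.
\<close>

definition narrow_gaussian :: "nat \<Rightarrow> real \<Rightarrow> complex" where
  "narrow_gaussian n y = of_real (real (Suc n) * std_normal_density (real (Suc n) * y))"

lemma narrow_gaussian_rescale:
  "(LINT y|lborel. narrow_gaussian n y * h y)
    = (LINT u|lborel. of_real (std_normal_density u) * h (u / Suc n))"
  using lborel_integral_real_affine[of "1 / Suc n" "\<lambda>y. narrow_gaussian n y * h y" 0]
  by (simp add: narrow_gaussian_def scaleR_conv_of_real mult.assoc del: of_nat_Suc)

lemma integrable_narrow_gaussian: "integrable lborel (narrow_gaussian n)"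
  using lborel_integrable_real_affine[OF integrable_gaussian, of "Suc n" 0]
  by (simp add: narrow_gaussian_def[abs_def] del: of_nat_Suc)

lemma nrm1_narrow_gaussian: "nrm1 (narrow_gaussian n) = 1"
proof -
  have "complex_of_real (nrm1 (narrow_gaussian n)) = (LINT y|lborel. narrow_gaussian n y * 1)"
    unfolding nrm1_def
    by (subst integral_complex_of_real[symmetric])
      (simp add: narrow_gaussian_def norm_mult del: of_nat_Suc)
  also have "\<dots> = 1"
    unfolding narrow_gaussian_rescale using integral_gaussian_cis[of 0] by simp
  finally show ?thesis by simp
qed

lemma fourier_narrow_gaussian:
  "fourier (narrow_gaussian n) w = of_real (exp (- (1 / (2 * (real (Suc n))\<^sup>2) * w\<^sup>2)))"
proof -
  have "fourier (narrow_gaussian n) w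
      = (LINT u|lborel. of_real (std_normal_density u) * cis ((w / Suc n) * u))"
    unfolding fourier_def narrow_gaussian_rescale by simp
  also have "\<dots> = of_real (exp (- (w / Suc n)\<^sup>2 / 2))" by (rule integral_gaussian_cis)
  finally show ?thesis by (simp add: power_divide mult.commute del: of_nat_Suc)
qed

lemma integrable_indicator_interval: "integrable lborel (indicator {a..b::real} :: real \<Rightarrow> complex)"
proof -
  have "integrable lborel (\<lambda>x. indicator {a..b} x *\<^sub>R (1::complex))"
    by (intro integrable_indicator) (auto simp: emeasure_lborel_Icc_eq)
  moreover have "(\<lambda>x. indicator {a..b} x *\<^sub>R (1::complex)) = indicator {a..b}"
    by (auto simp: fun_eq_iff indicator_def)
  ultimately show ?thesis by simp
qed

text \<open>
  Smoothing the indicator by ever narrower Gaussians converges to it except at the two end points,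
  and does not increase the \<open>L\<^sub>1\<close>-norm; by Scheffe's lemma the convergence is then in \<open>L\<^sub>1\<close>.
\<close>

lemma tame_approximable_interval: "tame_approximable (indicator {a..b})"
proof -
  let ?h = "indicator {a..b} :: real \<Rightarrow> complex"
  note hi = integrable_indicator_interval[of a b]
  define p where "p n = twisted_conv 1 (-1) ?h (narrow_gaussian n)" for n
  have pi: "integrable lborel (p n)" for n
    unfolding p_def by (intro twisted_conv_integrable hi integrable_narrow_gaussian) auto
  have fp: "fourier (p n) = (\<lambda>w. fourier ?h w * fourier (narrow_gaussian n) w)" for n
    unfolding p_def
    using fourier_twisted_conv[OF _ hi integrable_narrow_gaussian, of 1 "-1"] by auto
  have tame_p: "\<exists>K S1 S2. tame K (fourier (p n)) S1 S2" for n
  proof -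
    have "0 < 1 / (2 * (real (Suc n))\<^sup>2)" by simp
    from tame_gaussian[OF this] obtain K G1 G2 where
      "tame K (fourier (narrow_gaussian n)) G1 G2"
      unfolding fourier_narrow_gaussian[abs_def] by blast
    moreover obtain H1 H2 B where
      "\<And>w. (fourier ?h has_vector_derivative H1 w) (at w)"
      "\<And>w. (H1 has_vector_derivative H2 w) (at w)" "continuous_on UNIV H2"
      "\<And>w. norm (fourier ?h w) \<le> B" "\<And>w. norm (H1 w) \<le> B" "\<And>w. norm (H2 w) \<le> B"
      using fourier_indicator_interval_C2[of a b] by blast
    ultimately show ?thesis unfolding fp by (blast intro: tame_mult)
  qed
  have pw: "(\<lambda>n. p n x) \<longlonglongrightarrow> ?h x" if "x \<noteq> a" "x \<noteq> b" for x
  proof -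
    have pe: "p n x = (LINT u|lborel. of_real (std_normal_density u) * ?h (x - u / Suc n))" for n
      unfolding p_def twisted_conv_def narrow_gaussian_rescale by simp
    have "(\<lambda>n. p n x) \<longlonglongrightarrow> (LINT u|lborel. of_real (std_normal_density u) * ?h x)"
      unfolding pe
    proof (rule integral_dominated_convergence[where w="std_normal_density"])
      have "(\<lambda>n. ?h (x - u / Suc n)) \<longlonglongrightarrow> ?h x" for u
      proof -
        have l: "(\<lambda>n. x - u / Suc n) \<longlonglongrightarrow> x"
          using tendsto_diff[OF tendsto_const LIMSEQ_Suc[OF lim_const_over_n[of u]], of x] by simp
        \<comment> \<open>The indicator is constant on a neighbourhood of \<open>x\<close>.\<close>
        define S where "S = (if x \<in> {a..b} then {a<..<b} else - {a..b})"
        have "open S" "x \<in> S" using that by (auto simp: S_def)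
        from topological_tendstoD[OF l this] have "eventually (\<lambda>n. ?h (x - u / Suc n) = ?h x) sequentially"
          by eventually_elim (auto simp: S_def indicator_def split: if_splits)
        then show ?thesis by (rule tendsto_eventually)
      qed
      then show "AE u in lborel. (\<lambda>n. of_real (std_normal_density u) * ?h (x - u / Suc n))
          \<longlonglongrightarrow> of_real (std_normal_density u) * ?h x"
        by (intro always_eventually allI tendsto_intros)
      show "AE u in lborel. norm (of_real (std_normal_density u) * ?h (x - u / Suc n)) \<le> std_normal_density u" for n
        by (auto simp: indicator_def norm_mult)
      show "integrable lborel std_normal_density" by (intro integrable_normal_density) auto
    qed auto
    moreover have "(LINT u|lborel. of_real (std_normal_density u) * ?h x) = ?h x"
      using integral_gaussian_cis[of 0] by simp
    ultimately show ?thesis by simp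
  qed
  have np: "nrm1 (p n) \<le> nrm1 ?h" for n
    unfolding p_def
    using nrm1_twisted_conv[OF _ hi integrable_narrow_gaussian, of 1 "-1"]
    by (simp add: nrm1_narrow_gaussian)
  have lim: "(\<lambda>n. \<integral>\<^sup>+x. norm (p n x - ?h x) \<partial>lborel) \<longlonglongrightarrow> 0"
  proof (rule Scheffe_lemma1[OF pi hi])
    have "AE x in lborel. x \<noteq> a" "AE x in lborel. x \<noteq> b"
      by (rule AE_lborel_singleton)+
    then show "AE x in lborel. (\<lambda>n. p n x) \<longlonglongrightarrow> ?h x"
      by eventually_elim (rule pw)
    have "(\<integral>\<^sup>+x. norm (p n x) \<partial>lborel) \<le> (\<integral>\<^sup>+x. norm (?h x) \<partial>lborel)" for n
      using np[of n] pi[of n] hi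
      by (simp add: nn_integral_eq_integral integrable_norm nrm1_def ennreal_leI)
    then show "limsup (\<lambda>n. \<integral>\<^sup>+x. norm (p n x) \<partial>lborel) \<le> (\<integral>\<^sup>+x. norm (?h x) \<partial>lborel)"
      by (intro Limsup_bounded always_eventually allI) auto
  qed
  show ?thesis
    unfolding tame_approximable_def
  proof (intro conjI allI impI hi)
    fix e :: real assume e: "0 < e"
    from order_tendstoD(2)[OF lim, of "ennreal e"] e
    obtain n where n: "(\<integral>\<^sup>+x. norm (p n x - ?h x) \<partial>lborel) < ennreal e"
      by (auto dest: eventually_happens)
    have "integrable lborel (\<lambda>x. norm (p n x - ?h x))" using pi hi by auto
    then have "nrm1 (\<lambda>x. ?h x - p n x) < e"
      using n e by (simp add: nn_integral_eq_integral nrm1_def norm_minus_commute ennreal_less_iff)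
    with tame_p[of n] pi[of n]
    show "\<exists>p K S1 S2. integrable lborel p \<and> tame K (fourier p) S1 S2 \<and> nrm1 (\<lambda>x. ?h x - p x) < e"
      by blast
  qed
qed

text \<open>
  A Dynkin system argument: the half-lines \<open>{..c}\<close> generate the Borel sets and are stable under
  intersection, and cutting down to \<open>{-N..N}\<close> turns them into intervals and keeps all indicators
  integrable.
\<close>

lemma tame_approximable_bounded_borel:
  fixes N :: real
  assumes "A \<in> sets borel"
  shows "tame_approximable (indicator (A \<inter> {-N..N}))"
proof -
  have "Int_stable (range (atMost :: real \<Rightarrow> _))"
    by (auto simp: Int_stable_def)
  moreover have "range (atMost :: real \<Rightarrow> _) \<subseteq> Pow UNIV" by simp
  moreover have "A \<in> sigma_sets UNIV (range atMost)"
    using assms by (simp add: borel_eq_atMost sets_measure_of)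
  ultimately show ?thesis
  proof (induction rule: sigma_sets_induct_disjoint)
    case (basic A)
    then obtain c where "A = {..c}" by auto
    then have "A \<inter> {-N..N} = {-N..min c N}" by auto
    then show ?case using tame_approximable_interval by simp
  next
    case empty
    have e: "{} \<inter> {-N..N} = {1..0::real}" by auto
    show ?case unfolding e by (rule tame_approximable_interval)
  next
    case (compl A)
    have "indicator ((UNIV - A) \<inter> {-N..N})
        = (\<lambda>x. indicator {-N..N} x + (-1) * indicator (A \<inter> {-N..N}) x :: complex)"
      by (auto simp: fun_eq_iff indicator_def)
    then show ?case
      using tame_approximable_add[OF tame_approximable_interval tame_approximable_cmult[OF compl(2)], of "-N" N "-1"]
      by simp
  next
    case (union A)
    have A [measurable]: "A i \<in> sets borel" for i
      using union(2) by (auto simp: borel_eq_atMost sets_measure_of)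
    define s where "s n x = (\<Sum>i<n. indicator (A i \<inter> {-N..N}) x :: complex)" for n x
    have se: "s n x = indicator ((\<Union>i<n. A i) \<inter> {-N..N}) x" for n x
    proof -
      have "disjoint_family_on (\<lambda>i. A i \<inter> {-N..N}) {..<n}"
        using union(1) by (auto simp: disjoint_family_on_def)
      from indicator_UN_disjoint[OF _ this, of x] have
        "indicator (\<Union>i<n. A i \<inter> {-N..N}) x = s n x" by (simp add: s_def)
      then show ?thesis by (simp add: Int_UN_distrib2)
    qed
    show ?case
    proof (rule tame_approximable_limit[where s=s])
      show "tame_approximable (s n)" for n
      proof (induction n)
        case 0
        show ?case using tame_approximable_cmult[OF tame_approximable_interval[of 0 0], of 0]
          by (simp add: s_def[abs_def])
      next
        case (Suc n)
        then show ?case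
          using tame_approximable_add[OF Suc union(3)[of n]] by (simp add: s_def[abs_def])
      qed
      show "AE x in lborel. (\<lambda>n. s n x) \<longlonglongrightarrow> indicator ((\<Union>i. A i) \<inter> {-N..N}) x"
      proof (intro always_eventually allI)
        fix x
        have "(\<lambda>n. indicator (\<Union>i<n. A i) x * indicator {-N..N} x :: complex)
            \<longlonglongrightarrow> indicator (\<Union>i. A i) x * indicator {-N..N} x"
          by (intro tendsto_mult tendsto_const LIMSEQ_indicator_UN)
        then show "(\<lambda>n. s n x) \<longlonglongrightarrow> indicator ((\<Union>i. A i) \<inter> {-N..N}) x"
          by (simp add: se indicator_inter_arith)
      qed
      show "integrable lborel (indicator {-N..N} :: real \<Rightarrow> real)"
        by (intro integrable_real_indicator) (auto simp: emeasure_lborel_Icc_eq)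
    qed (auto simp: se indicator_def)
  qed
qed

theorem integrable_tame_approximable:
  assumes "integrable lborel f"
  shows "tame_approximable f"
  using assms
proof (induction rule: integrable_induct)
  case (base A c)
  have [measurable]: "A \<in> sets borel" using base by simp
  have Ai: "integrable lborel (indicator A :: real \<Rightarrow> real)"
    using base by (intro integrable_real_indicator) auto
  have "tame_approximable (indicator A)"
  proof (rule tame_approximable_limit[OF _ _ _ Ai])
    show "tame_approximable (indicator (A \<inter> {- real n..real n}))" for n
      by (rule tame_approximable_bounded_borel) simp
    show "AE x in lborel. (\<lambda>n. indicator (A \<inter> {- real n..real n}) x :: complex) \<longlonglongrightarrow> indicator A x"
    proof (rule always_eventually, rule allI, rule tendsto_eventually)
      fix x :: real
      obtain m where m: "\<bar>x\<bar> \<le> real m" using real_arch_simple by blast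
      show "eventually (\<lambda>n. indicator (A \<inter> {- real n..real n}) x = (indicator A x :: complex)) sequentially"
        using eventually_ge_at_top[of m]
      proof eventually_elim
        case (elim n)
        then have "x \<in> {- real n..real n}" using m by auto
        then show ?case by (simp add: indicator_def)
      qed
    qed
  qed (auto simp: indicator_def)
  moreover have "(\<lambda>x. indicator A x *\<^sub>R c) = (\<lambda>x. c * indicator A x)"
    by (auto simp: fun_eq_iff indicator_def)
  ultimately show ?case using tame_approximable_cmult[of "indicator A" c] by simp
next
  case (add f g)
  then show ?case by (intro tame_approximable_add)
next
  case (lim f s)
  have [measurable]: "f \<in> borel_measurable borel" using lim by auto
  show ?case
    by (rule tame_approximable_limit[where s=s and g="\<lambda>x. 2 * norm (f x)"]) (use lim in auto)
qed

section \<open>The Wiener-Levy theorem\<close>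

lemma has_field_derivative_inverse_power:
  fixes z :: complex
  assumes "1 + z \<noteq> 0"
  shows "((\<lambda>z. inverse (1 + z) ^ n) has_field_derivative - of_nat n * inverse (1 + z) ^ Suc n) (at z)"
proof (cases n)
  case (Suc m)
  have "((\<lambda>z. inverse (1 + z)) has_field_derivative - (inverse (1 + z) * 1 * inverse (1 + z))) (at z)"
    using assms by (auto intro!: derivative_eq_intros)
  then show ?thesis
    by (rule DERIV_cong[OF DERIV_power[of _ _ _ _ n]]) (simp add: Suc algebra_simps)
qed auto

text \<open>
  With \<open>V = 1 / (1 + S)\<close> the first hypothesis holds. The factor \<open>norm S\<close> in the bound is what lets
  \<open>V ^ n - 1\<close> inherit the decay of \<open>S\<close>.
\<close>

lemma norm_power_diff_1_le:
  fixes S V :: complex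
  assumes V: "V - 1 = - (S * V)" "norm V \<le> R" and R: "1 \<le> R"
  shows "norm (V ^ n - 1) \<le> real n * R ^ n * norm S"
proof (induction n)
  case (Suc n)
  have "V ^ Suc n - 1 = V * (V ^ n - 1) + (V - 1)" by (simp add: algebra_simps)
  also have "norm \<dots> \<le> R * (real n * R ^ n * norm S) + R ^ Suc n * norm S"
  proof (rule norm_triangle_mono)
    show "norm (V * (V ^ n - 1)) \<le> R * (real n * R ^ n * norm S)"
      unfolding norm_mult using R by (intro mult_mono Suc V) auto
    have "R ^ 1 \<le> R ^ Suc n" using R by (intro power_increasing) auto
    then have "norm V \<le> R ^ Suc n" using V(2) by simp
    then show "norm (V - 1) \<le> R ^ Suc n * norm S"
      unfolding V(1) norm_minus_cancel norm_mult mult.commute[of "norm S"]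
      by (rule mult_right_mono) simp
  qed
  also have "\<dots> = real (Suc n) * R ^ Suc n * norm S" by (simp add: algebra_simps)
  finally show ?case .
qed simp

text \<open>
  The point is the quadratic factor: differentiating \<open>1 / (1 + S) ^ n\<close> twice costs only a polynomial
  in \<open>n\<close>, so the geometric rate \<open>R ^ n\<close> is that of the supremum norm of \<open>1 / (1 + S)\<close>.
\<close>

lemma tame_inverse_power:
  assumes S: "tame K S S1 S2" and V: "\<And>w. norm (inverse (1 + S w)) \<le> R" and R: "1 \<le> R"
    and nz: "\<And>w. 1 + S w \<noteq> 0"
  shows "\<exists>Q1 Q2. tame ((real n + 1)\<^sup>2 * R ^ (n + 2) * (K + K\<^sup>2)) (\<lambda>w. inverse (1 + S w) ^ n - 1) Q1 Q2"
proof -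
  have d: "\<And>w. (S has_vector_derivative S1 w) (at w)" "\<And>w. (S1 has_vector_derivative S2 w) (at w)"
    and c2: "continuous_on UNIV S2"
    and b: "\<And>w. norm (S w) \<le> K / (1 + w\<^sup>2)" "\<And>w. norm (S1 w) \<le> K / (1 + w\<^sup>2)"
      "\<And>w. norm (S2 w) \<le> K / (1 + w\<^sup>2)"
    using S by (auto simp: tame_def)
  have c: "continuous_on UNIV S" "continuous_on UNIV S1"
    using d by (auto intro!: continuous_at_imp_continuous_on has_vector_derivative_continuous)
  define V' where "V' w = inverse (1 + S w)" for w
  have V'n: "norm (V' w ^ k) \<le> R ^ k" for w k
    unfolding norm_power V'_def by (intro power_mono V) simp
  have dV: "((\<lambda>w. V' w ^ k) has_vector_derivative S1 w * (- of_nat k * V' w ^ Suc k)) (at w)" for k w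
    using field_vector_diff_chain_at[OF d(1)[of w] has_field_derivative_inverse_power[OF nz[of w], where n=k]]
    by (simp add: o_def V'_def)
  define M where "M = (real n + 1)\<^sup>2 * R ^ (n + 2)"
  have M: "real n * R ^ k \<le> M" "real n * (real n + 1) * R ^ k \<le> M" if "k \<le> n + 2" for k
  proof -
    have r: "R ^ k \<le> R ^ (n + 2)" using R that by (rule power_increasing[rotated])
    have n: "real n \<le> (real n + 1)\<^sup>2" "real n * (real n + 1) \<le> (real n + 1)\<^sup>2"
      by (simp_all add: power2_eq_square algebra_simps)
    show "real n * R ^ k \<le> M" "real n * (real n + 1) * R ^ k \<le> M"
      unfolding M_def using R by (intro mult_mono r n; simp)+
  qed
  have M0: "0 \<le> M" using R by (simp add: M_def)
  have K0: "0 \<le> K / (1 + w\<^sup>2)" for w using b(1)[of w] norm_ge_zero order_trans by blast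
  then have K: "0 \<le> K" using K0[of 0] by simp
  have k: "M * (K / (1 + w\<^sup>2)) \<le> M * (K + K\<^sup>2) / (1 + w\<^sup>2)" for w
    unfolding times_divide_eq_right using M0 K
    by (intro divide_right_mono mult_left_mono) (auto simp: add_nonneg_nonneg)
  let ?Q1 = "\<lambda>w. S1 w * (- of_nat n * V' w ^ Suc n)"
  let ?Q2 = "\<lambda>w. S1 w * (- of_nat n * (S1 w * (- of_nat (Suc n) * V' w ^ Suc (Suc n))))
    + S2 w * (- of_nat n * V' w ^ Suc n)"
  have "tame (M * (K + K\<^sup>2)) (\<lambda>w. V' w ^ n - 1) ?Q1 ?Q2"
    unfolding tame_def
  proof (intro conjI allI)
    fix w
    show "((\<lambda>w. V' w ^ n - 1) has_vector_derivative ?Q1 w) (at w)"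
      using has_vector_derivative_diff[OF dV[of n w] has_vector_derivative_const[of 1]] by simp
    show "(?Q1 has_vector_derivative ?Q2 w) (at w)"
      by (rule has_vector_derivative_mult[OF d(2) has_vector_derivative_mult_right[OF dV]])
    have "V' w - 1 = - (S w * V' w)" using nz[of w] by (simp add: V'_def field_simps)
    from norm_power_diff_1_le[OF this _ R, of n] V'n[of w 1]
    have "norm (V' w ^ n - 1) \<le> real n * R ^ n * norm (S w)" by simp
    also have "\<dots> \<le> M * (K / (1 + w\<^sup>2))" using M0 by (intro mult_mono M b) auto
    finally show "norm (V' w ^ n - 1) \<le> M * (K + K\<^sup>2) / (1 + w\<^sup>2)" using k by (rule order_trans)
    have e1: "norm (z * (- of_nat n * V' w ^ Suc n)) \<le> M * (K / (1 + w\<^sup>2))"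
      if z: "norm z \<le> K / (1 + w\<^sup>2)" for z
    proof -
      have "norm (z * (- of_nat n * V' w ^ Suc n)) = (real n * norm (V' w ^ Suc n)) * norm z"
        unfolding norm_mult norm_minus_cancel norm_of_nat by simp
      also have "\<dots> \<le> (real n * R ^ Suc n) * norm z"
        by (intro mult_mono mult_left_mono V'n) (use R in auto)
      also have "\<dots> \<le> M * (K / (1 + w\<^sup>2))"
        by (intro mult_mono M z) (use M0 in auto)
      finally show ?thesis .
    qed
    show "norm (?Q1 w) \<le> M * (K + K\<^sup>2) / (1 + w\<^sup>2)"
      by (rule order_trans[OF e1[OF b(2)] k])
    have "norm (S1 w) \<le> K / 1"
      using b(2)[of w] by (rule order_trans) (intro divide_left_mono, auto simp: K add_pos_nonneg)
    then have S1K: "norm (S1 w) \<le> K" by simp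
    have "norm (S1 w * (- of_nat n * (S1 w * (- of_nat (Suc n) * V' w ^ Suc (Suc n)))))
        = (real n * (real n + 1) * norm (V' w ^ Suc (Suc n))) * (norm (S1 w) * norm (S1 w))"
      unfolding norm_mult norm_minus_cancel norm_of_nat by simp
    also have "\<dots> \<le> (real n * (real n + 1) * R ^ Suc (Suc n)) * (norm (S1 w) * norm (S1 w))"
      by (intro mult_mono mult_left_mono V'n) (use R in auto)
    also have "\<dots> \<le> M * (K * (K / (1 + w\<^sup>2)))"
      by (intro mult_mono M S1K b) (use M0 K in auto)
    finally have e2: "norm (S1 w * (- of_nat n * (S1 w * (- of_nat (Suc n) * V' w ^ Suc (Suc n)))))
        \<le> M * (K * (K / (1 + w\<^sup>2)))" .
    have "norm (?Q2 w) \<le> M * (K * (K / (1 + w\<^sup>2))) + M * (K / (1 + w\<^sup>2))"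
      by (rule norm_triangle_mono[OF e2 e1[OF b(3)]])
    also have "\<dots> = M * (K + K\<^sup>2) / (1 + w\<^sup>2)"
      by (simp add: power2_eq_square add_divide_distrib[symmetric] distrib_left add.commute)
    finally show "norm (?Q2 w) \<le> M * (K + K\<^sup>2) / (1 + w\<^sup>2)" .
  next
    have "continuous_on UNIV V'" unfolding V'_def by (intro continuous_intros c) (use nz in auto)
    then show "continuous_on UNIV ?Q2" by (intro continuous_intros c c2)
  qed
  then show ?thesis unfolding M_def V'_def by blast
qed

text \<open>
  Outside a compact interval \<open>fourier f\<close> is at most \<open>1 / 2\<close> in norm, since it is uniformly within
  \<open>1 / 4\<close> of a transform with quadratic decay; on the interval continuity and the absence of zeros
  give a positive minimum.
\<close>

lemma one_plus_fourier_bounded_below: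
  assumes f: "integrable lborel f" and nz: "\<And>w. 1 + fourier f w \<noteq> 0"
  obtains \<delta> where "0 < \<delta>" "\<delta> \<le> 1" "\<And>w. \<delta> \<le> norm (1 + fourier f w)"
proof -
  have "tame_approximable f" by (rule integrable_tame_approximable[OF f])
  then obtain p K S1 S2 where p: "integrable lborel p" "tame K (fourier p) S1 S2"
    "nrm1 (\<lambda>x. f x - p x) < 1 / 4"
    unfolding tame_approximable_def by (metis zero_less_divide_1_iff zero_less_numeral)
  have fp: "norm (fourier f w - fourier p w) \<le> 1 / 4" for w
    using norm_fourier_le[of "\<lambda>x. f x - p x" w] p fourier_diff[OF f p(1), of w] by simp
  \<comment> \<open>Then \<open>R \<le> \<bar>w\<bar>\<close> forces \<open>w\<^sup>2 \<ge> \<bar>w\<bar> \<ge> 4 * K\<close>; the summand \<open>1\<close> ensures \<open>\<bar>w\<bar> \<ge> 1\<close>.\<close>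
  define R where "R = 4 * \<bar>K\<bar> + 1"
  have far: "1 / 2 \<le> norm (1 + fourier f w)" if w: "R \<le> \<bar>w\<bar>" for w
  proof -
    have "1 * \<bar>w\<bar> \<le> \<bar>w\<bar> * \<bar>w\<bar>" using w by (intro mult_right_mono) (auto simp: R_def)
    then have "\<bar>w\<bar> \<le> w\<^sup>2" by (simp add: power2_eq_square)
    then have "4 * K \<le> 1 + w\<^sup>2" using w abs_ge_self[of K] unfolding R_def by linarith
    moreover have "0 < 1 + w\<^sup>2" by (simp add: add_pos_nonneg)
    ultimately have "K / (1 + w\<^sup>2) \<le> 1 / 4" by (simp add: field_simps)
    moreover have "norm (fourier p w) \<le> K / (1 + w\<^sup>2)" using p by (auto simp: tame_def)
    ultimately have "norm (fourier p w) \<le> 1 / 4" by linarith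
    moreover have "norm (1::complex) \<le> norm (1 + fourier f w) + norm (fourier f w - fourier p w) + norm (fourier p w)"
    proof -
      have "(1::complex) = (1 + fourier f w) - (fourier f w - fourier p w) - fourier p w" by simp
      then show ?thesis
        by (metis norm_triangle_ineq4 norm_triangle_le_diff add_mono order_refl)
    qed
    ultimately show ?thesis using fp[of w] by simp
  qed
  have "continuous_on {-R..R} (\<lambda>w. norm (1 + fourier f w))"
    by (intro continuous_intros continuous_on_subset[OF continuous_fourier[OF f]]) auto
  moreover have R0: "{-R..R} \<noteq> {}" by (simp add: R_def)
  ultimately obtain w0 where w0: "\<And>w. w \<in> {-R..R} \<Longrightarrow> norm (1 + fourier f w0) \<le> norm (1 + fourier f w)"
    using continuous_attains_inf[OF compact_Icc, of "-R" R "\<lambda>w. norm (1 + fourier f w)"]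
    by blast
  show ?thesis
  proof (rule that[of "min (1 / 2) (norm (1 + fourier f w0))"])
    show "0 < min (1 / 2) (norm (1 + fourier f w0))" using nz by simp
    show "min (1 / 2) (norm (1 + fourier f w0)) \<le> norm (1 + fourier f w)" for w
      using w0[of w] far[of w] by (cases "w \<in> {-R..R}") (auto simp: min_le_iff_disj)
  qed simp
qed

text \<open>
  Newman's argument, as sketched at the beginning. With \<open>V = 1 / (1 + F p)\<close>, the function sought is
  \<open>- q 1 - (\<Sum>n. T n)\<close>, where \<open>F (q n) = V ^ n - 1\<close> and \<open>F (T n) = (F d) ^ (n + 1) * V ^ (n + 2)\<close>.
\<close>

theorem wiener_levy:
  assumes f: "integrable lborel f" and nz: "\<And>w. 1 + fourier f w \<noteq> 0"
  obtains m where "integrable lborel m" "\<And>w. fourier m w = fourier f w / (1 + fourier f w)"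
proof -
  obtain \<delta> where \<delta>: "0 < \<delta>" "\<delta> \<le> 1" "\<And>w. \<delta> \<le> norm (1 + fourier f w)"
    using one_plus_fourier_bounded_below[OF f nz] by blast
  have "tame_approximable f" by (rule integrable_tame_approximable[OF f])
  moreover have "0 < \<delta> / 3" using \<delta> by simp
  ultimately obtain p K S1 S2 where p: "integrable lborel p" "tame K (fourier p) S1 S2"
    "nrm1 (\<lambda>x. f x - p x) < \<delta> / 3"
    unfolding tame_approximable_def by blast
  define d where "d x = p x - f x" for x
  have d: "integrable lborel d" unfolding d_def using p f by auto
  have nd: "nrm1 d \<le> \<delta> / 3"
    using p(3) unfolding nrm1_def d_def by (simp add: norm_minus_commute)
  have fd: "fourier d w = fourier p w - fourier f w" for w
    unfolding d_def using p f by (intro fourier_diff)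
  have fdn: "norm (fourier d w) \<le> \<delta> / 3" for w using norm_fourier_le nd by (rule order_trans)
  have P: "2 * \<delta> / 3 \<le> norm (1 + fourier p w)" for w
  proof -
    have "1 + fourier f w = (1 + fourier p w) - fourier d w" by (simp add: fd)
    then have "norm (1 + fourier f w) \<le> norm (1 + fourier p w) + norm (fourier d w)"
      by (metis norm_triangle_ineq4)
    then show ?thesis using \<delta>(3)[of w] fdn[of w] by linarith
  qed
  \<comment> \<open>The bound for \<open>1 / (1 + F p)\<close>; its product with the bound \<open>\<delta> / 3\<close> for \<open>F d\<close> is \<open>1 / 2\<close>.\<close>
  define R where "R = 3 / (2 * \<delta>)"
  have R1: "1 \<le> R" and R: "\<delta> / 3 * R = 1 / 2" using \<delta> by (auto simp: R_def field_simps)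
  have Pnz: "1 + fourier p w \<noteq> 0" for w using P[of w] \<delta> by auto
  define V where "V w = inverse (1 + fourier p w)" for w
  have Vn: "norm (V w) \<le> R" for w
  proof -
    have "norm (V w) \<le> inverse (2 * \<delta> / 3)"
      unfolding V_def norm_inverse by (rule le_imp_inverse_le[OF P]) (use \<delta> in auto)
    then show ?thesis by (simp add: R_def)
  qed
  define C where "C = (K + K\<^sup>2) * pi"
  have "\<exists>q. integrable lborel q \<and> fourier q = (\<lambda>w. V w ^ n - 1)
      \<and> nrm1 q \<le> (real n + 1)\<^sup>2 * R ^ (n + 2) * C" for n
  proof -
    obtain Q1 Q2 where "tame ((real n + 1)\<^sup>2 * R ^ (n + 2) * (K + K\<^sup>2)) (\<lambda>w. V w ^ n - 1) Q1 Q2"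
      using tame_inverse_power[OF p(2) _ R1 Pnz, of n] Vn unfolding V_def by blast
    from tame_is_fourier[OF this] show ?thesis by (metis C_def mult.assoc)
  qed
  then obtain q where q: "\<And>n. integrable lborel (q n)" "\<And>n. fourier (q n) = (\<lambda>w. V w ^ n - 1)"
    "\<And>n. nrm1 (q n) \<le> (real n + 1)\<^sup>2 * R ^ (n + 2) * C" by metis
  \<comment> \<open>The convolution power of \<open>d\<close> with \<open>n + 1\<close> factors.\<close>
  define D where "D n = ((\<lambda>g. twisted_conv 1 (-1) g d) ^^ n) d" for n
  have D: "integrable lborel (D n) \<and> (\<forall>w. fourier (D n) w = fourier d w ^ Suc n)
      \<and> nrm1 (D n) \<le> (\<delta> / 3) ^ Suc n" for n
  proof (induction n)
    case 0
    show ?case using d nd by (simp add: D_def)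
  next
    case (Suc n)
    have Dn: "integrable lborel (D n)" and e: "D (Suc n) = twisted_conv 1 (-1) (D n) d"
      using Suc by (simp_all add: D_def)
    have "nrm1 (D (Suc n)) \<le> nrm1 (D n) * nrm1 d"
      unfolding e using Dn d by (intro nrm1_twisted_conv) auto
    also have "\<dots> \<le> (\<delta> / 3) ^ Suc n * (\<delta> / 3)"
      using Suc nd \<delta> by (intro mult_mono nrm1_nonneg) auto
    finally have "nrm1 (D (Suc n)) \<le> (\<delta> / 3) ^ Suc (Suc n)" by (simp add: mult.commute)
    moreover have "integrable lborel (D (Suc n))"
      unfolding e using Dn d by (intro twisted_conv_integrable) auto
    moreover have "fourier (D (Suc n)) w = fourier d w ^ Suc (Suc n)" for w
      unfolding e using fourier_twisted_conv[OF _ Dn d, of 1 "-1" w] Suc by simp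
    ultimately show ?case by blast
  qed
  \<comment> \<open>Since \<open>F (q (n + 2)) + 1 = V ^ (n + 2)\<close>, adding \<open>D n\<close> replaces \<open>V ^ (n + 2) - 1\<close> by \<open>V ^ (n + 2)\<close>.\<close>
  define T where "T n x = D n x + twisted_conv 1 (-1) (D n) (q (n + 2)) x" for n x
  have ci: "integrable lborel (twisted_conv 1 (-1) (D n) (q (n + 2)))" for n
    using D[of n] q by (intro twisted_conv_integrable) auto
  have T: "integrable lborel (T n)" for n
    unfolding T_def using D[of n] ci by auto
  have fT: "fourier (T n) w = fourier d w * (V w)\<^sup>2 * (fourier d w * V w) ^ n" for n w
  proof -
    have "fourier (T n) w = fourier (D n) w + fourier (D n) w * (V w ^ (n + 2) - 1)"
      unfolding T_def using D[of n] ci[of n] q fourier_twisted_conv[of 1 "D n" "q (n + 2)" "-1" w]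
      by (simp add: fourier_add)
    also have "\<dots> = fourier d w ^ Suc n * V w ^ (n + 2)" using D[of n] by (simp add: algebra_simps)
    finally show ?thesis by (simp add: power_add power_mult_distrib power2_eq_square mult_ac)
  qed
  have C0: "0 \<le> C"
  proof -
    have "0 \<le> K" using p(2) norm_ge_zero[of "fourier p 0"]
      unfolding tame_def by (metis add_0_right div_by_1 order_trans power_zero_numeral)
    then show ?thesis by (simp add: C_def)
  qed
  have nT: "nrm1 (T n) \<le> (1 / 2) ^ Suc n + R ^ 3 * C * ((real n + 3)\<^sup>2 * (1 / 2) ^ Suc n)" for n
  proof -
    have "nrm1 (T n) \<le> nrm1 (D n) + nrm1 (D n) * nrm1 (q (n + 2))"
      unfolding T_def using D[of n] q ci
      by (intro order_trans[OF nrm1_triangle] add_left_mono nrm1_twisted_conv) auto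
    also have "\<dots> \<le> (\<delta> / 3) ^ Suc n + (\<delta> / 3) ^ Suc n * ((real n + 3)\<^sup>2 * R ^ (n + 4) * C)"
    proof -
      have "nrm1 (q (n + 2)) \<le> (real n + 3)\<^sup>2 * R ^ (n + 4) * C"
        using q(3)[of "n + 2"] by (simp add: add.commute numeral_eq_Suc)
      then show ?thesis
        using D[of n] \<delta> by (intro add_mono mult_mono nrm1_nonneg) auto
    qed
    also have "\<dots> = (\<delta> / 3) ^ Suc n + R ^ 3 * C * ((real n + 3)\<^sup>2 * (\<delta> / 3 * R) ^ Suc n)"
      unfolding power_mult_distrib by (simp add: power_add numeral_eq_Suc mult_ac)
    also have "\<dots> \<le> (1 / 2) ^ Suc n + R ^ 3 * C * ((real n + 3)\<^sup>2 * (1 / 2) ^ Suc n)"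
      unfolding R using \<delta> by (intro add_mono power_mono order_refl) auto
    finally show ?thesis .
  qed
  have "summable (\<lambda>n. nrm1 (T n))"
  proof (rule summable_comparison_test')
    have "summable (\<lambda>n. (real n + 3)\<^sup>2 * (1 / 2) ^ Suc n)"
    proof (rule summable_comparison_test_bigo)
      show "summable (\<lambda>n. norm ((3 / 4 :: real) ^ n))" by (simp add: summable_geometric)
      show "(\<lambda>n. (real n + 3)\<^sup>2 * (1 / 2) ^ Suc n) \<in> O(\<lambda>n. (3 / 4) ^ n)" by real_asymp
    qed
    then show "summable (\<lambda>n. (1 / 2) ^ Suc n + R ^ 3 * C * ((real n + 3)\<^sup>2 * (1 / 2) ^ Suc n))"
      by (intro summable_add summable_mult) (simp_all add: summable_geometric)
    show "norm (nrm1 (T n)) \<le> (1 / 2) ^ Suc n + R ^ 3 * C * ((real n + 3)\<^sup>2 * (1 / 2) ^ Suc n)" for n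
      using nT[of n] nrm1_nonneg[of "T n"] by simp
  qed
  from integrable_suminf_nrm1[OF T this] obtain m where
    m: "integrable lborel m" "\<And>w. (\<lambda>n. fourier (T n) w) sums fourier m w" by blast
  have small: "norm (fourier d w * V w) < 1" for w
  proof -
    have "norm (fourier d w * V w) \<le> \<delta> / 3 * R"
      unfolding norm_mult using \<delta> by (intro mult_mono fdn Vn) auto
    then show ?thesis unfolding R by simp
  qed
  have fm: "fourier m w = fourier d w * (V w)\<^sup>2 * (1 / (1 - fourier d w * V w))" for w
    using m(2)[of w] sums_mult[OF geometric_sums[OF small[of w]], of "fourier d w * (V w)\<^sup>2"]
    unfolding fT by (rule sums_unique2)
  show ?thesis
  proof (rule that)
    show "integrable lborel (\<lambda>x. - 1 * q 1 x - m x)" using q m by auto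
    fix w
    let ?u = "fourier f w" and ?P = "1 + fourier p w"
    have "fourier (\<lambda>x. - 1 * q 1 x - m x) w = - 1 * fourier (q 1) w - fourier m w"
      using q(1)[of 1] m(1) fourier_diff[of "\<lambda>x. - 1 * q 1 x" m w] fourier_cmult[of "-1" "q 1" w] by simp
    also have "\<dots> = 1 - (V w + fourier d w * (V w)\<^sup>2 * (1 / (1 - fourier d w * V w)))"
      by (simp add: q(2) fm)
    also have "V w + fourier d w * (V w)\<^sup>2 * (1 / (1 - fourier d w * V w)) = V w / (1 - fourier d w * V w)"
    proof -
      have "1 - fourier d w * V w \<noteq> 0" using small[of w] by auto
      then show ?thesis by (simp add: field_simps power2_eq_square)
    qed
    also have "\<dots> = 1 / (?P * (1 - fourier d w * V w))"
      unfolding V_def by (simp add: divide_inverse)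
    also have "?P * (1 - fourier d w * V w) = 1 + ?u"
      using Pnz[of w] by (simp add: V_def fd field_simps)
    also have "1 - 1 / (1 + ?u) = ?u / (1 + ?u)" using nz[of w] by (simp add: field_simps)
    finally show "fourier (\<lambda>x. - 1 * q 1 x - m x) w = ?u / (1 + ?u)" .
  qed
qed

section \<open>Injectivity of the Fourier transform\<close>

text \<open>
  The positive and negative parts of \<open>g\<close> have equal transforms, in particular (at \<open>0\<close>) equal mass \<open>m\<close>.
  Unless \<open>m = 0\<close>, they become probability densities after division by \<open>m\<close>, and Levy's uniqueness
  theorem identifies the two distributions.
\<close>

lemma real_integrable_fourier_eq_0:
  fixes g :: "real \<Rightarrow> real"
  assumes g: "integrable lborel g" and z: "\<And>w. fourier (\<lambda>x. of_real (g x)) w = 0"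
  shows "AE x in lborel. g x = 0"
proof -
  define a where "a x = max 0 (g x)" for x
  define b where "b x = max 0 (- g x)" for x
  have ab: "g x = a x - b x" "0 \<le> a x" "0 \<le> b x" for x by (auto simp: a_def b_def)
  have ai: "integrable lborel a" using g by (auto simp: a_def[abs_def])
  have bi: "integrable lborel b" using g by (auto simp: b_def[abs_def])
  have [measurable]: "a \<in> borel_measurable borel" "b \<in> borel_measurable borel" using ai bi by auto
  have eq: "fourier (\<lambda>x. of_real (a x)) w = fourier (\<lambda>x. of_real (b x)) w" for w
    using z[of w] fourier_diff[of "\<lambda>x. of_real (a x)" "\<lambda>x. of_real (b x)" w] ai bi
    by (simp add: ab(1))
  define m where "m = (LINT x|lborel. a x)"
  have mb: "m = (LINT x|lborel. b x)"
    using eq[of 0] by (simp add: m_def fourier_def)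
  show ?thesis
  proof (cases "m = 0")
    case True
    then have "AE x in lborel. a x = 0" "AE x in lborel. b x = 0"
      using ab mb integral_nonneg_eq_0_iff_AE[OF ai] integral_nonneg_eq_0_iff_AE[OF bi]
      by (auto simp: m_def)
    then show ?thesis by eventually_elim (simp add: ab)
  next
    case False
    moreover have "0 \<le> m" unfolding m_def using ab by (intro integral_nonneg_AE) auto
    ultimately have m: "0 < m" by simp
    define N where "N h = density lborel (\<lambda>x. ennreal (h x / m))" for h :: "real \<Rightarrow> real"
    have N: "real_distribution (N h)" "char (N h) t = fourier (\<lambda>x. of_real (h x)) t / of_real m"
      if h: "integrable lborel h" "\<And>x. 0 \<le> h x" "m = (LINT x|lborel. h x)" for h t
    proof -
      have [measurable]: "h \<in> borel_measurable borel" using h by auto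
      have "emeasure (N h) (space (N h)) = (\<integral>\<^sup>+x. ennreal (h x / m) \<partial>lborel)"
        unfolding N_def by (subst emeasure_density) auto
      also have "\<dots> = ennreal (LINT x|lborel. h x / m)"
        using h m by (intro nn_integral_eq_integral) auto
      also have "\<dots> = 1" using h(3) m by simp
      finally have "prob_space (N h)" by (rule prob_spaceI)
      then show "real_distribution (N h)"
        by (simp add: real_distribution_def real_distribution_axioms_def N_def)
      have "char (N h) t = (LINT x|lborel. (h x / m) *\<^sub>R iexp (t * x))"
        unfolding char_def N_def using h m by (intro integral_density) auto
      also have "\<dots> = (LINT x|lborel. of_real (h x) * cis (t * x) / of_real m)"
        by (simp add: scaleR_conv_of_real cis_conv_exp)
      finally show "char (N h) t = fourier (\<lambda>x. of_real (h x)) t / of_real m"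
        by (simp add: fourier_def)
    qed
    have "N a = N b"
      using ab ai bi m_def mb eq by (intro Levy_uniqueness ext) (simp_all add: N)
    then have "AE x in lborel. ennreal (a x / m) = ennreal (b x / m)"
      unfolding N_def by (subst (asm) sigma_finite_measure.density_unique_iff[OF sigma_finite_lborel]) auto
    then show ?thesis
    proof eventually_elim
      case (elim x)
      then have "a x / m = b x / m" using ab m by (simp add: ennreal_inj)
      then show ?case using m ab(1)[of x] by simp
    qed
  qed
qed

text \<open>
  The transform of \<open>cnj \<circ> f\<close> is a reflected conjugate of that of \<open>f\<close>, so it vanishes too, and the real
  and imaginary parts can be treated separately.
\<close>

theorem fourier_eq_0_imp_AE_eq_0:
  assumes f: "integrable lborel f" and z: "\<And>w. fourier f w = 0"
  shows "AE x in lborel. f x = 0"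
proof -
  have cf: "integrable lborel (\<lambda>x. cnj (f x))" using f by simp
  have cz: "fourier (\<lambda>x. cnj (f x)) w = 0" for w
  proof -
    have "fourier (\<lambda>x. cnj (f x)) w = (LINT x|lborel. cnj (f x * cis (- w * x)))"
      by (simp add: fourier_def cis_cnj)
    also have "\<dots> = cnj (fourier f (- w))"
      unfolding fourier_def by (rule Bochner_Integration.integral_cnj)
    finally show ?thesis using z by simp
  qed
  have "AE x in lborel. Re (f x) = 0"
  proof (rule real_integrable_fourier_eq_0)
    have "(\<lambda>x. of_real (Re (f x))) = (\<lambda>x. (1 / 2) * (f x + cnj (f x)))"
      by (auto simp: complex_add_cnj)
    then show "fourier (\<lambda>x. of_real (Re (f x))) w = 0" for w
      using fourier_cmult[of "1 / 2" "\<lambda>x. f x + cnj (f x)" w] fourier_add[OF f cf, of w] z cz by simp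
  qed (use f in auto)
  moreover have "AE x in lborel. Im (f x) = 0"
  proof (rule real_integrable_fourier_eq_0)
    have "(\<lambda>x. of_real (Im (f x))) = (\<lambda>x. (1 / (2 * \<i>)) * (f x - cnj (f x)))"
      by (auto simp: complex_eq_iff)
    then show "fourier (\<lambda>x. of_real (Im (f x))) w = 0" for w
      using fourier_cmult[of "1 / (2 * \<i>)" "\<lambda>x. f x - cnj (f x)" w] fourier_diff[OF f cf, of w] z cz by simp
  qed (use f in auto)
  ultimately show ?thesis by eventually_elim (simp add: complex_eq_iff)
qed

section \<open>The Hartley transform through the Fourier transform\<close>

text \<open>
  Elements of \<open>L1\<close> are Lebesgue measurable, while Fubini's theorem on the product of two copies of
  the line is used for Borel measurable functions; a Borel representative mediates between the two.
\<close>

lemma L1_borel_representative: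
  assumes "f \<in> L1"
  obtains f' where "integrable lborel f'" "AE x in lborel. f x = f' x"
proof -
  have fi: "integrable lebesgue f" using assms by (simp add: L1_def)
  then have "(\<lambda>x. Re (f x)) \<in> borel_measurable lebesgue" "(\<lambda>x. Im (f x)) \<in> borel_measurable lebesgue"
    by auto
  from this[THEN completion_ex_borel_measurable_real] obtain u v where
    u: "u \<in> borel_measurable lborel" "AE x in lborel. Re (f x) = u x" and
    v: "v \<in> borel_measurable lborel" "AE x in lborel. Im (f x) = v x" by auto
  define f' where "f' x = Complex (u x) (v x)" for x
  have "f' = (\<lambda>x. of_real (u x) + \<i> * of_real (v x))" by (auto simp: f'_def complex_eq_iff)
  with u v have meas: "f' \<in> borel_measurable lborel" by simp
  have ae: "AE x in lborel. f x = f' x"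
    using u(2) v(2) by eventually_elim (simp add: f'_def complex_eq_iff)
  have "integrable lebesgue f'"
    using integrable_cong_AE_imp[OF fi measurable_completion[OF meas]] AE_completion[OF ae] by simp
  then have "integrable lborel f'" using integrable_completion[OF meas] by simp
  then show ?thesis using ae by (rule that)
qed

lemma integral_lebesgue_AE_borel:
  fixes f :: "real \<Rightarrow> 'b::euclidean_space"
  assumes ae: "AE x in lborel. f x = g x" and g: "g \<in> borel_measurable borel"
  shows "(LINT x|lebesgue. f x) = (LINT x|lborel. g x)"
proof -
  have ae': "AE x in lebesgue. g x = f x"
    using AE_completion[OF ae] by eventually_elim simp
  have gm: "g \<in> borel_measurable lebesgue" using g by (simp add: measurable_completion)
  have "(LINT x|lebesgue. f x) = (LINT x|lebesgue. g x)"
    by (rule integral_cong_AE[OF borel_measurable_AE[OF gm ae'] gm AE_completion[OF ae]])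
  also have "\<dots> = (LINT x|lborel. g x)" using g by (intro integral_completion) simp
  finally show ?thesis .
qed

lemma AE_lborel_affine:
  fixes P :: "real \<Rightarrow> bool"
  assumes "c \<noteq> 0" "AE x in lborel. P x"
  shows "AE x in lborel. P (t + c * x)"
proof -
  from assms(2) obtain N where N: "{x. \<not> P x} \<subseteq> N" "N \<in> null_sets lborel"
    by (auto elim!: AE_E simp: null_sets_def)
  then have [measurable]: "N \<in> sets borel" by auto
  have "AE x in lborel. x \<notin> N" using N(2) by (rule AE_not_in)
  from AE_borel_affine[OF assms(1) _ this, of t] have "AE x in lborel. t + c * x \<notin> N" by simp
  then show ?thesis by eventually_elim (use N in auto)
qed

lemma hartley_H1_fourier:
  assumes f: "integrable lborel f'" and ae: "AE x in lborel. f x = f' x"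
  shows "hartley_H1 f y = ((1 - \<i>) / 2 * fourier f' y + (1 + \<i>) / 2 * fourier f' (- y)) / of_real (sqrt (2 * pi))"
proof -
  have [measurable]: "f' \<in> borel_measurable borel" using f by auto
  have cas: "complex_of_real (cos t + sin t) = (1 - \<i>) / 2 * cis t + (1 + \<i>) / 2 * cis (- t)" for t
    by (simp add: complex_eq_iff field_simps)
  have "(LINT x|lebesgue. f x * complex_of_real (cos (x * y) + sin (x * y)))
      = (LINT x|lborel. f' x * complex_of_real (cos (x * y) + sin (x * y)))"
    by (rule integral_lebesgue_AE_borel) (use ae in auto)
  also have "\<dots> = (LINT x|lborel. (1 - \<i>) / 2 * (f' x * cis (y * x)) + (1 + \<i>) / 2 * (f' x * cis (- y * x)))"
    unfolding cas by (simp add: algebra_simps)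
  also have "\<dots> = (1 - \<i>) / 2 * fourier f' y + (1 + \<i>) / 2 * fourier f' (- y)"
    using integrable_mult_cis[OF f, of y] integrable_mult_cis[OF f, of "- y"]
    by (simp add: fourier_def)
  finally show ?thesis by (simp add: hartley_H1_def)
qed

text \<open>
  The identities at \<open>y\<close> and at \<open>- y\<close> form a linear system for \<open>F f (y)\<close> and \<open>F f (- y)\<close> with
  determinant \<open>(1 - \<i>)\<^sup>2 - (1 + \<i>)\<^sup>2 = - 4 * \<i>\<close>.
\<close>

lemma hartley_H1_inj_borel:
  assumes f: "integrable lborel f" and z: "\<And>y. hartley_H1 f y = 0"
  shows "AE x in lborel. f x = 0"
proof (rule fourier_eq_0_imp_AE_eq_0[OF f])
  fix w
  have e: "(1 - \<i>) * fourier f w + (1 + \<i>) * fourier f (- w) = 0"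
    "(1 - \<i>) * fourier f (- w) + (1 + \<i>) * fourier f w = 0"
    using z[of w] z[of "- w"] hartley_H1_fourier[OF f, of f]
    by (simp_all add: add_divide_distrib[symmetric])
  have "- 4 * \<i> * F = (1 - \<i>) * ((1 - \<i>) * F + (1 + \<i>) * G) - (1 + \<i>) * ((1 - \<i>) * G + (1 + \<i>) * F)"
    for F G by (simp add: complex_eq_iff algebra_simps)
  from this[of "fourier f w" "fourier f (- w)"] show "fourier f w = 0" unfolding e by simp
qed

text \<open>
  The two generalized convolutions with their integrands split into four terms. The split is
  legitimate only where all four integrals exist, so these agree with \<open>hartley_conv\<close> and
  \<open>hartley_fourier_conv\<close> almost everywhere; unlike them they are Borel measurable
  whenever \<open>f\<close> and \<open>g\<close> are.
\<close>

definition hartley_prod :: "(real \<Rightarrow> complex) \<Rightarrow> (real \<Rightarrow> complex) \<Rightarrow> real \<Rightarrow> complex" where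
  "hartley_prod f g x = of_real (1 / (2 * sqrt (2 * pi))) *
     (twisted_conv 1 1 g f x + twisted_conv 1 (-1) g f x
      + twisted_conv (-1) 1 g f x - twisted_conv (-1) (-1) g f x)"

definition hartley_fourier_prod :: "(real \<Rightarrow> complex) \<Rightarrow> (real \<Rightarrow> complex) \<Rightarrow> real \<Rightarrow> complex" where
  "hartley_fourier_prod f g x = of_real (1 / (2 * sqrt (2 * pi))) *
     (twisted_conv 1 1 f g x + twisted_conv 1 (-1) f g x
      + \<i> * twisted_conv (-1) (-1) f g x - \<i> * twisted_conv (-1) 1 f g x)"

context
  fixes f g f' g' :: "real \<Rightarrow> complex"
  assumes f: "integrable lborel f'" "AE x in lborel. f x = f' x"
    and g: "integrable lborel g'" "AE x in lborel. g x = g' x"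
begin

private lemma abs_minus_one: "\<bar>-1::real\<bar> = 1"
  by simp

private lemma minus_one_neq_zero: "(-1::real) \<noteq> 0"
  by simp

private lemma reps_measurable [measurable]: "f' \<in> borel_measurable borel" "g' \<in> borel_measurable borel"
  using f g by auto

lemma hartley_conv_AE: "AE x in lborel. hartley_conv f g x = hartley_prod f' g' x"
  using twisted_conv_AE[OF abs_one g(1) f(1), where t=1]
    twisted_conv_AE[OF abs_one g(1) f(1), where t="-1"]
    twisted_conv_AE[OF abs_minus_one g(1) f(1), where t=1]
    twisted_conv_AE[OF abs_minus_one g(1) f(1), where t="-1"]
proof eventually_elim
  case (elim x)
  have "(LINT y|lebesgue. f y * (g (x + y) + g (x - y) + g (- x + y) - g (- x - y)))
    = (LINT y|lborel. f' y * (g' (x + y) + g' (x - y) + g' (- x + y) - g' (- x - y)))"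
  proof (rule integral_lebesgue_AE_borel)
    show "AE y in lborel. f y * (g (x + y) + g (x - y) + g (- x + y) - g (- x - y))
        = f' y * (g' (x + y) + g' (x - y) + g' (- x + y) - g' (- x - y))"
      using f(2) AE_lborel_affine[OF one_neq_zero g(2), where t=x] AE_lborel_affine[OF minus_one_neq_zero g(2), where t=x]
        AE_lborel_affine[OF one_neq_zero g(2), where t="-x"] AE_lborel_affine[OF minus_one_neq_zero g(2), where t="-x"]
      by eventually_elim simp
  qed measurable
  also have "\<dots> = (LINT y|lborel. f' y * g' (x + y) + f' y * g' (x - y) + f' y * g' (y - x) - f' y * g' (- x - y))"
    by (simp add: algebra_simps)
  also have "\<dots> = twisted_conv 1 1 g' f' x + twisted_conv 1 (-1) g' f' x
      + twisted_conv (-1) 1 g' f' x - twisted_conv (-1) (-1) g' f' x"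
    using elim by (simp add: twisted_conv_def)
  finally show ?case by (simp add: hartley_conv_def hartley_prod_def)
qed

lemma hartley_fourier_conv_AE:
  "AE x in lborel. hartley_fourier_conv f g x = hartley_fourier_prod f' g' x"
  using twisted_conv_AE[OF abs_one f(1) g(1), where t=1]
    twisted_conv_AE[OF abs_one f(1) g(1), where t="-1"]
    twisted_conv_AE[OF abs_minus_one f(1) g(1), where t=1]
    twisted_conv_AE[OF abs_minus_one f(1) g(1), where t="-1"]
proof eventually_elim
  case (elim x)
  have "(LINT y|lebesgue. g y * (f (x + y) + f (x - y) + \<i> * f (- x - y) - \<i> * f (- x + y)))
    = (LINT y|lborel. g' y * (f' (x + y) + f' (x - y) + \<i> * f' (- x - y) - \<i> * f' (- x + y)))"
  proof (rule integral_lebesgue_AE_borel)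
    show "AE y in lborel. g y * (f (x + y) + f (x - y) + \<i> * f (- x - y) - \<i> * f (- x + y))
        = g' y * (f' (x + y) + f' (x - y) + \<i> * f' (- x - y) - \<i> * f' (- x + y))"
      using g(2) AE_lborel_affine[OF one_neq_zero f(2), where t=x] AE_lborel_affine[OF minus_one_neq_zero f(2), where t=x]
        AE_lborel_affine[OF one_neq_zero f(2), where t="-x"] AE_lborel_affine[OF minus_one_neq_zero f(2), where t="-x"]
      by eventually_elim simp
  qed measurable
  also have "\<dots> = (LINT y|lborel. g' y * f' (x + y) + g' y * f' (x - y)
      + \<i> * (g' y * f' (- x - y)) - \<i> * (g' y * f' (y - x)))"
    by (simp add: algebra_simps)
  also have "\<dots> = twisted_conv 1 1 f' g' x + twisted_conv 1 (-1) f' g' x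
      + \<i> * twisted_conv (-1) (-1) f' g' x - \<i> * twisted_conv (-1) 1 f' g' x"
    using elim by (simp add: twisted_conv_def)
  finally show ?case by (simp add: hartley_fourier_conv_def hartley_fourier_prod_def)
qed

end

context
  fixes f g :: "real \<Rightarrow> complex"
  assumes f: "integrable lborel f" and g: "integrable lborel g"
begin

lemma integrable_hartley_prod: "integrable lborel (hartley_prod f g)"
  unfolding hartley_prod_def[abs_def] using f g
  by (intro integrable_mult_right Bochner_Integration.integrable_add
      Bochner_Integration.integrable_diff twisted_conv_integrable) auto

lemma integrable_hartley_fourier_prod: "integrable lborel (hartley_fourier_prod f g)"
  unfolding hartley_fourier_prod_def[abs_def] using f g
  by (intro integrable_mult_right Bochner_Integration.integrable_add
      Bochner_Integration.integrable_diff twisted_conv_integrable) auto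

lemma hartley_H1_hartley_prod:
  "hartley_H1 (hartley_prod f g) y = hartley_H1 f y * hartley_H1 g y"
proof -
  \<comment> \<open>As \<open>c\<close> is opaque, the identity becomes one of rational functions.\<close>
  define c where "c = complex_of_real (sqrt (2 * pi))"
  have F: "fourier (hartley_prod f g) w = (1 / (2 * c)) *
     (fourier g w * fourier f (- w) + fourier g w * fourier f w
      + fourier g (- w) * fourier f w - fourier g (- w) * fourier f (- w))" for w
    unfolding hartley_prod_def[abs_def] fourier_cmult using f g
    by (simp add: fourier_add fourier_diff twisted_conv_integrable fourier_twisted_conv c_def)
  have c: "c \<noteq> 0" by (simp add: c_def)
  show ?thesis
    unfolding hartley_H1_fourier[OF integrable_hartley_prod AE_I2[OF refl]]
      hartley_H1_fourier[OF f AE_I2[OF refl]] hartley_H1_fourier[OF g AE_I2[OF refl]]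
      F c_def[symmetric] minus_minus
    using c by (simp add: field_simps)
qed

lemma hartley_H1_hartley_fourier_prod:
  "hartley_H1 (hartley_fourier_prod f g) y = hartley_H1 f y * (fourier g (- y) / of_real (sqrt (2 * pi)))"
proof -
  define c where "c = complex_of_real (sqrt (2 * pi))"
  have F: "fourier (hartley_fourier_prod f g) w = (1 / (2 * c)) *
     (fourier f w * fourier g (- w) + fourier f w * fourier g w
      + \<i> * (fourier f (- w) * fourier g (- w)) - \<i> * (fourier f (- w) * fourier g w))" for w
    unfolding hartley_fourier_prod_def[abs_def] fourier_cmult using f g
    by (simp add: fourier_add fourier_diff fourier_cmult twisted_conv_integrable fourier_twisted_conv c_def)
  have c: "c \<noteq> 0" by (simp add: c_def)
  show ?thesis
    unfolding hartley_H1_fourier[OF integrable_hartley_fourier_prod AE_I2[OF refl]]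
      hartley_H1_fourier[OF f AE_I2[OF refl]]
      F c_def[symmetric] minus_minus
    using c by (simp add: field_simps)
qed

lemma nrm1_hartley_fourier_prod:
  "nrm1 (hartley_fourier_prod f g) \<le> sqrt (2 / pi) * nrm1 f * nrm1 g"
proof -
  let ?B = "nrm1 f * nrm1 g" and ?c = "1 / (2 * sqrt (2 * pi))"
  define A where "A = twisted_conv 1 1 f g"
  define B where "B = twisted_conv 1 (-1) f g"
  define C where "C x = \<i> * twisted_conv (-1) (-1) f g x" for x
  define D where "D x = - \<i> * twisted_conv (-1) 1 f g x" for x
  have i: "integrable lborel A" "integrable lborel B" "integrable lborel C" "integrable lborel D"
    unfolding A_def B_def C_def[abs_def] D_def[abs_def]
    by (intro integrable_mult_right twisted_conv_integrable f g; simp)+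
  have n: "nrm1 A \<le> ?B" "nrm1 B \<le> ?B" "nrm1 C \<le> ?B" "nrm1 D \<le> ?B"
    using nrm1_twisted_conv[OF _ f g]
    by (simp_all add: A_def B_def C_def[abs_def] D_def[abs_def] nrm1_cmult[of "- \<i>", simplified]
        nrm1_cmult)
  have "hartley_fourier_prod f g = (\<lambda>x. of_real ?c * (A x + (B x + (C x + D x))))"
    unfolding hartley_fourier_prod_def by (simp add: fun_eq_iff add.assoc A_def B_def C_def D_def)
  then have "nrm1 (hartley_fourier_prod f g) = ?c * nrm1 (\<lambda>x. A x + (B x + (C x + D x)))"
    by (simp only: nrm1_cmult norm_of_real) simp
  also have "\<dots> \<le> ?c * (nrm1 A + (nrm1 B + (nrm1 C + nrm1 D)))"
    using nrm1_triangle[of A "\<lambda>x. B x + (C x + D x)"] nrm1_triangle[of B "\<lambda>x. C x + D x"]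
      nrm1_triangle[of C D] i by (intro mult_left_mono) auto
  also have "\<dots> \<le> ?c * (?B + (?B + (?B + ?B)))"
    by (intro mult_left_mono add_mono n) auto
  also have "\<dots> = sqrt (2 / pi) * nrm1 f * nrm1 g"
  proof -
    have c: "?c * 4 = sqrt (2 / pi)"
      by (rule real_sqrt_unique[symmetric]) (simp_all add: power2_eq_square field_simps)
    have "?c * (?B + (?B + (?B + ?B))) = (?c * 4) * ?B" by simp
    then show ?thesis unfolding c by simp
  qed
  finally show ?thesis .
qed

end

section \<open>The integral equation\<close>

text \<open>
  Both sides of the integral equation agree almost everywhere with integrable functions, and \<open>H\<^sub>1\<close> is injective and
  multiplicative, so the equation may be solved for \<open>H\<^sub>1 f\<close>.
\<close>

lemma is_L1_solution_iff:
  assumes \<phi>: "\<phi> \<in> L1" and nz: "\<And>y. 1 + hartley_H1 \<phi> y \<noteq> 0"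
    and \<xi>: "integrable lborel \<xi>'" "AE x in lborel. \<xi> x = \<xi>' x"
    and f: "f \<in> L1"
  shows "is_L1_solution \<phi> \<xi> f \<longleftrightarrow> (\<forall>y. hartley_H1 f y =
    hartley_H1 \<phi> y / (1 + hartley_H1 \<phi> y) * (fourier \<xi>' (- y) / of_real (sqrt (2 * pi))))"
proof -
  obtain f' where f': "integrable lborel f'" "AE x in lborel. f x = f' x"
    using L1_borel_representative[OF f] .
  obtain \<phi>' where \<phi>': "integrable lborel \<phi>'" "AE x in lborel. \<phi> x = \<phi>' x"
    using L1_borel_representative[OF \<phi>] .
  let ?D = "\<lambda>x. f' x + hartley_prod f' \<phi>' x - hartley_fourier_prod \<phi>' \<xi>' x"
  note i = integrable_hartley_prod[OF f'(1) \<phi>'(1)] integrable_hartley_fourier_prod[OF \<phi>'(1) \<xi>(1)]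
  have D: "integrable lborel ?D" using f' i by auto
  have H: "hartley_H1 f y = hartley_H1 f' y" "hartley_H1 \<phi> y = hartley_H1 \<phi>' y" for y
    using hartley_H1_fourier[OF f'] hartley_H1_fourier[OF f'(1) AE_I2[OF refl]]
      hartley_H1_fourier[OF \<phi>'] hartley_H1_fourier[OF \<phi>'(1) AE_I2[OF refl]] by simp_all
  have HD: "hartley_H1 ?D y = hartley_H1 f y + hartley_H1 f y * hartley_H1 \<phi> y
      - hartley_H1 \<phi> y * (fourier \<xi>' (- y) / of_real (sqrt (2 * pi)))" for y
  proof -
    have "hartley_H1 ?D y = hartley_H1 f' y + hartley_H1 (hartley_prod f' \<phi>') y
        - hartley_H1 (hartley_fourier_prod \<phi>' \<xi>') y"
      unfolding hartley_H1_fourier[OF D AE_I2[OF refl]] hartley_H1_fourier[OF f'(1) AE_I2[OF refl]]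
        hartley_H1_fourier[OF i(1) AE_I2[OF refl]] hartley_H1_fourier[OF i(2) AE_I2[OF refl]]
      using f'(1) i by (simp add: fourier_add fourier_diff field_simps)
    then show ?thesis
      by (simp add: H hartley_H1_hartley_prod[OF f'(1) \<phi>'(1)]
          hartley_H1_hartley_fourier_prod[OF \<phi>'(1) \<xi>(1)])
  qed
  have "is_L1_solution \<phi> \<xi> f \<longleftrightarrow> (AE x in lborel. ?D x = 0)"
  proof -
    have "AE x in lborel. (f x + hartley_conv f \<phi> x = hartley_fourier_conv \<phi> \<xi> x) \<longleftrightarrow> ?D x = 0"
      using f'(2) hartley_conv_AE[OF f' \<phi>'] hartley_fourier_conv_AE[OF \<phi>' \<xi>]
      by eventually_elim simp
    then have "(AE x in lborel. f x + hartley_conv f \<phi> x = hartley_fourier_conv \<phi> \<xi> x)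
        \<longleftrightarrow> (AE x in lborel. ?D x = 0)"
      by (rule eventually_cong[OF _ ] ; simp)
    then show ?thesis using f by (simp add: is_L1_solution_def AE_completion_iff)
  qed
  also have "\<dots> \<longleftrightarrow> (\<forall>y. hartley_H1 ?D y = 0)"
  proof
    assume "AE x in lborel. ?D x = 0"
    then show "\<forall>y. hartley_H1 ?D y = 0"
      using hartley_H1_fourier[of "\<lambda>x. 0" ?D] by simp
  next
    assume "\<forall>y. hartley_H1 ?D y = 0"
    then show "AE x in lborel. ?D x = 0" using hartley_H1_inj_borel[OF D] by blast
  qed
  also have "\<dots> \<longleftrightarrow> (\<forall>y. hartley_H1 f y =
    hartley_H1 \<phi> y / (1 + hartley_H1 \<phi> y) * (fourier \<xi>' (- y) / of_real (sqrt (2 * pi))))"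
  proof -
    have "(a + a * h - h * u = 0) \<longleftrightarrow> (a = h / (1 + h) * u)" if "1 + h \<noteq> 0" for a h u :: complex
      using that by (simp add: field_simps)
    then show ?thesis unfolding HD using nz by blast
  qed
  finally show ?thesis .
qed

lemma hartley_H1_eq_imp_AE_eq:
  assumes f: "f \<in> L1" and g: "g \<in> L1" and eq: "\<And>y. hartley_H1 f y = hartley_H1 g y"
  shows "AE x in lebesgue. f x = g x"
proof -
  obtain f' where f': "integrable lborel f'" "AE x in lborel. f x = f' x"
    using L1_borel_representative[OF f] .
  obtain g' where g': "integrable lborel g'" "AE x in lborel. g x = g' x"
    using L1_borel_representative[OF g] .
  have D: "integrable lborel (\<lambda>x. f' x - g' x)" using f' g' by auto
  have "hartley_H1 (\<lambda>x. f' x - g' x) y = hartley_H1 f y - hartley_H1 g y" for y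
    unfolding hartley_H1_fourier[OF D AE_I2[OF refl]] hartley_H1_fourier[OF f'] hartley_H1_fourier[OF g']
    using f' g' by (simp add: fourier_diff field_simps)
  then have "AE x in lborel. f' x - g' x = 0"
    using hartley_H1_inj_borel[OF D] eq by simp
  then have "AE x in lborel. f x = g x"
    using f'(2) g'(2) by eventually_elim simp
  then show ?thesis by (rule AE_completion)
qed

lemma integrable_lborel_L1:
  assumes "integrable lborel f"
  shows "f \<in> L1"
  using assms integrable_completion[of f lborel] by (auto simp: L1_def)

lemma L1_norm_eq_nrm1:
  assumes "integrable lborel f'" "AE x in lborel. f x = f' x"
  shows "L1_norm f = nrm1 f'"
  unfolding L1_norm_def nrm1_def
proof (rule integral_lebesgue_AE_borel)
  show "AE x in lborel. norm (f x) = norm (f' x)" using assms(2) by eventually_elim simp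
qed (use assms in auto)

text \<open>
  \<open>H\<^sub>1 \<phi>\<close> is the Fourier transform of the combination \<open>\<psi>\<close> of \<open>\<phi>\<close> and its reflection. The Wiener-Levy
  theorem solves the problem for \<open>\<psi>\<close>, and the inverse combination \<open>l\<close> of the result and its reflection
  has that Fourier transform as its Hartley transform.
\<close>

lemma resolvent_kernel_exists:
  assumes \<phi>: "\<phi> \<in> L1" and nz: "\<And>y. 1 + hartley_H1 \<phi> y \<noteq> 0"
  obtains l where "integrable lborel l" "is_resolvent_kernel \<phi> l"
proof -
  obtain \<phi>' where \<phi>': "integrable lborel \<phi>'" "AE x in lborel. \<phi> x = \<phi>' x"
    using L1_borel_representative[OF \<phi>] .
  define c where "c = complex_of_real (sqrt (2 * pi))"
  have c: "c \<noteq> 0" by (simp add: c_def)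
  define a b where "a = (1 - \<i>) / (2 * c)" and "b = (1 + \<i>) / (2 * c)"
  define \<psi> where "\<psi> x = a * \<phi>' x + b * \<phi>' (- x)" for x
  have \<psi>: "integrable lborel \<psi>"
    unfolding \<psi>_def using \<phi>'(1) integrable_reflect[OF \<phi>'(1)] by auto
  have H: "fourier \<psi> y = hartley_H1 \<phi> y" for y
  proof -
    have "fourier \<psi> y = a * fourier \<phi>' y + b * fourier \<phi>' (- y)"
      unfolding \<psi>_def using \<phi>'(1) integrable_reflect[OF \<phi>'(1)]
      by (simp add: fourier_add fourier_cmult fourier_reflect)
    also have "\<dots> = hartley_H1 \<phi> y"
      unfolding hartley_H1_fourier[OF \<phi>'] c_def[symmetric] a_def b_def
      by (simp add: add_divide_distrib distrib_right left_diff_distrib diff_divide_distrib)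
    finally show ?thesis .
  qed
  obtain m where m: "integrable lborel m" "\<And>w. fourier m w = fourier \<psi> w / (1 + fourier \<psi> w)"
    using wiener_levy[OF \<psi>] nz unfolding H by blast
  define a' b' where "a' = c * (1 + \<i>) / 2" and "b' = c * (1 - \<i>) / 2"
  define l where "l x = a' * m x + b' * m (- x)" for x
  have l: "integrable lborel l"
    unfolding l_def using m(1) integrable_reflect[OF m(1)] by auto
  have "fourier l w = a' * fourier m w + b' * fourier m (- w)" for w
    unfolding l_def using m(1) integrable_reflect[OF m(1)]
    by (simp add: fourier_add fourier_cmult fourier_reflect)
  then have fl: "fourier l w = c * ((1 + \<i>) / 2 * fourier m w + (1 - \<i>) / 2 * fourier m (- w))" for w
    by (simp add: a'_def b'_def algebra_simps)
  have "(1 - \<i>) / 2 * (c * ((1 + \<i>) / 2 * u + (1 - \<i>) / 2 * v))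
      + (1 + \<i>) / 2 * (c * ((1 + \<i>) / 2 * v + (1 - \<i>) / 2 * u)) = c * u" for u v
    by (simp add: field_simps)
  then have "hartley_H1 l y = fourier m y" for y
    unfolding hartley_H1_fourier[OF l AE_I2[OF refl]] c_def[symmetric] fl minus_minus
    using c by simp
  then have "is_resolvent_kernel \<phi> l"
    using m(2) integrable_lborel_L1[OF l] by (simp add: is_resolvent_kernel_def H)
  with l show ?thesis by (rule that)
qed

theorem theorem4p3:
  fixes \<phi> \<xi> :: "real \<Rightarrow> complex"
  assumes "\<phi> \<in> L1" and "\<xi> \<in> L1"
    and "\<And>y. 1 + hartley_H1 \<phi> y \<noteq> 0"
  shows "(\<exists>f. is_L1_solution \<phi> \<xi> f \<and>
            (\<forall>g. is_L1_solution \<phi> \<xi> g \<longrightarrow> (AE x in lebesgue. g x = f x))) \<and>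
         (\<exists>l. is_resolvent_kernel \<phi> l \<and>
            (\<forall>k. is_resolvent_kernel \<phi> k \<longrightarrow> (AE x in lebesgue. k x = l x))) \<and>
         (\<forall>f l. is_L1_solution \<phi> \<xi> f \<longrightarrow> is_resolvent_kernel \<phi> l \<longrightarrow>
            (AE x in lebesgue. f x = hartley_fourier_conv l \<xi> x) \<and>
            L1_norm f \<le> sqrt (2 / pi) * L1_norm l * L1_norm \<xi>)"
proof -
  obtain \<xi>' where \<xi>': "integrable lborel \<xi>'" "AE x in lborel. \<xi> x = \<xi>' x"
    using L1_borel_representative[OF assms(2)] .
  obtain l0 where l0: "integrable lborel l0" "is_resolvent_kernel \<phi> l0"
    using resolvent_kernel_exists[OF assms(1,3)] by blast
  note sol = is_L1_solution_iff[OF assms(1,3) \<xi>']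
  have L1: "f \<in> L1" if "is_L1_solution \<phi> \<xi> f" for f using that by (simp add: is_L1_solution_def)
  have solH: "hartley_H1 f y = hartley_H1 \<phi> y / (1 + hartley_H1 \<phi> y) * (fourier \<xi>' (- y) / of_real (sqrt (2 * pi)))"
    if "is_L1_solution \<phi> \<xi> f" for f y using sol[OF L1[OF that]] that by blast
  show ?thesis
  proof (intro conjI allI impI)
    let ?f = "hartley_fourier_prod l0 \<xi>'"
    have f: "?f \<in> L1"
      by (intro integrable_lborel_L1 integrable_hartley_fourier_prod l0 \<xi>')
    have "is_L1_solution \<phi> \<xi> ?f"
      unfolding sol[OF f] hartley_H1_hartley_fourier_prod[OF l0(1) \<xi>'(1)]
      using l0(2) by (simp add: is_resolvent_kernel_def)
    moreover have "AE x in lebesgue. g x = ?f x" if "is_L1_solution \<phi> \<xi> g" for g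
      using L1[OF that] f solH[OF that] solH[OF calculation] by (intro hartley_H1_eq_imp_AE_eq) simp_all
    ultimately show "\<exists>f. is_L1_solution \<phi> \<xi> f \<and>
        (\<forall>g. is_L1_solution \<phi> \<xi> g \<longrightarrow> (AE x in lebesgue. g x = f x))" by blast
  next
    have "AE x in lebesgue. k x = l0 x" if "is_resolvent_kernel \<phi> k" for k
      using that l0(2) by (intro hartley_H1_eq_imp_AE_eq) (simp_all add: is_resolvent_kernel_def)
    with l0(2) show "\<exists>l. is_resolvent_kernel \<phi> l \<and>
        (\<forall>k. is_resolvent_kernel \<phi> k \<longrightarrow> (AE x in lebesgue. k x = l x))" by blast
  next
    fix f l assume f: "is_L1_solution \<phi> \<xi> f" and l: "is_resolvent_kernel \<phi> l"
    have "l \<in> L1" using l by (simp add: is_resolvent_kernel_def)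
    then obtain l' where l': "integrable lborel l'" "AE x in lborel. l x = l' x"
      by (rule L1_borel_representative)
    let ?p = "hartley_fourier_prod l' \<xi>'"
    have p: "integrable lborel ?p" by (rule integrable_hartley_fourier_prod[OF l'(1) \<xi>'(1)])
    have "hartley_H1 f y = hartley_H1 ?p y" for y
      unfolding hartley_H1_hartley_fourier_prod[OF l'(1) \<xi>'(1)] solH[OF f]
      using l hartley_H1_fourier[OF l'] hartley_H1_fourier[OF l'(1) AE_I2[OF refl]]
      by (simp add: is_resolvent_kernel_def)
    then have "AE x in lebesgue. f x = ?p x"
      using L1[OF f] integrable_lborel_L1[OF p] by (intro hartley_H1_eq_imp_AE_eq)
    then have fp: "AE x in lborel. f x = ?p x" by (simp add: AE_completion_iff)
    have "AE x in lborel. f x = hartley_fourier_conv l \<xi> x"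
      using fp hartley_fourier_conv_AE[OF l' \<xi>'] by eventually_elim simp
    then show "AE x in lebesgue. f x = hartley_fourier_conv l \<xi> x" by (rule AE_completion)
    show "L1_norm f \<le> sqrt (2 / pi) * L1_norm l * L1_norm \<xi>"
      unfolding L1_norm_eq_nrm1[OF p fp] L1_norm_eq_nrm1[OF l'] L1_norm_eq_nrm1[OF \<xi>']
      by (rule nrm1_hartley_fourier_prod[OF l'(1) \<xi>'(1)])
  qed
qed

end
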